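(* In the setting of the context, the fidelity between the original ciphertext and the anamorphic ciphertext satisfies \[ F\big(M_f^{(0)},M_f^{(1)}\big)\;\ge\;1-\frac1\eta . \]
   Context: Let $d_1\ge d_2\ge1$, $\mathcal H_M=(\mathbb C^2)^{\otimes d_1}$, $\mathcal H_{M_c}=(\mathbb C^2)^{\otimes d_2}$, and $U_k=\bigotimes_{j}X^{k_{2j-1}}Z^{k_{2j}}$ (Pauli $X,Z$) for bit strings $k$. $M_o$ is a strictly positive definite density matrix on $\mathcal H_M$, $M_c$ a density matrix on $\mathcal H_{M_c}$; $M_o'=U_kM_oU_k^\dagger$ ($k\in\{0,1\}^{2d_1}$), $M_c'=U_{k'}M_cU_{k'}^\dagger$ ($k'\in\{0,1\}^{2d_2}$), $V|\psi\rangle=|\psi\rangle\otimes|0\rangle^{\otimes(d_1-d_2)}$, $M_c''=VM_c'V^\dagger$. For $\eta\in\mathbb Z^+$, on $\mathbb C^2\otimes\mathcal H_M$ (blocks w.r.t. the first qubit), $M_a^{(0)}=\begin{pmatrix}\frac12M_o'&0\\0&\frac12M_o'\end{pmatrix}$, $M_a^{(1)}=\begin{pmatrix}\frac12M_o'&\frac1\eta M_c''\\\frac1\eta(M_c'')^\dagger&\frac12M_o'\end{pmatrix}$, $M_f^{(b)}=U_\sigma M_a^{(b)}U_\sigma^\dagger$ with $U_\sigma$ a permutation matrix. Standing assumption: for a threshold $\varepsilon>0$, $1/\eta<\varepsilon$ and $\frac1{\eta^2}\|M_c''(M_o')^{-1}M_c''\|\le\frac14\lambda_{\min}(M_o')$.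 Fidelity: $F(\rho,\tau)=\operatorname{Tr}\sqrt{\sqrt\rho\,\tau\sqrt\rho}$. *)

theory Defs
  imports "HOL-Analysis.Analysis" "Jordan_Normal_Form.Schur_Decomposition"
begin

definition mtrace :: "complex mat \<Rightarrow> complex" where
  "mtrace A = (\<Sum>i<dim_row A. A $$ (i, i))"

definition hermitian :: "complex mat \<Rightarrow> bool" where
  "hermitian A \<longleftrightarrow> square_mat A \<and> mat_adjoint A = A"

definition psd :: "complex mat \<Rightarrow> bool" where
  "psd A \<longleftrightarrow> hermitian A \<and>
     (\<forall>v \<in> carrier_vec (dim_row A). Re (conjugate v \<bullet> (A *\<^sub>v v)) \<ge> 0)"

definition pd :: "complex mat \<Rightarrow> bool" where
  "pd A \<longleftrightarrow> hermitian A \<and>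
     (\<forall>v \<in> carrier_vec (dim_row A). v \<noteq> 0\<^sub>v (dim_row A) \<longrightarrow> Re (conjugate v \<bullet> (A *\<^sub>v v)) > 0)"

definition density_mat :: "nat \<Rightarrow> complex mat \<Rightarrow> bool" where
  "density_mat n A \<longleftrightarrow> A \<in> carrier_mat n n \<and> psd A \<and> mtrace A = 1"

definition mat_sqrt :: "complex mat \<Rightarrow> complex mat" where
  "mat_sqrt A = (THE B. B \<in> carrier_mat (dim_row A) (dim_row A) \<and> psd B \<and> B * B = A)"

definition fidelity :: "complex mat \<Rightarrow> complex mat \<Rightarrow> real" where
  "fidelity \<rho> \<tau> = Re (mtrace (mat_sqrt (mat_sqrt \<rho> * \<tau> * mat_sqrt \<rho>)))"

definition mat_inv :: "complex mat \<Rightarrow> complex mat" where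
  "mat_inv A = (THE B. B \<in> carrier_mat (dim_row A) (dim_row A) \<and> A * B = 1\<^sub>m (dim_row A)
                         \<and> B * A = 1\<^sub>m (dim_row A))"

definition vnorm :: "complex vec \<Rightarrow> real" where
  "vnorm v = sqrt (\<Sum>i<dim_vec v. (cmod (v $ i))\<^sup>2)"

definition op_norm :: "complex mat \<Rightarrow> real" where
  "op_norm A = Sup {vnorm (A *\<^sub>v v) | v. v \<in> carrier_vec (dim_col A) \<and> vnorm v \<le> 1}"

text \<open>smallest eigenvalue (eigenvalues of a Hermitian matrix are real)\<close>
definition lambda_min :: "complex mat \<Rightarrow> real" where
  "lambda_min A = Min (Re ` {l. eigenvalue A l})"

definition kron :: "complex mat \<Rightarrow> complex mat \<Rightarrow> complex mat" where
  "kron A B = mat (dim_row A * dim_row B) (dim_col A * dim_col B)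
     (\<lambda>(i, j). A $$ (i div dim_row B, j div dim_col B) * B $$ (i mod dim_row B, j mod dim_col B))"

definition pauli_X :: "complex mat" where
  "pauli_X = mat_of_rows_list 2 [[0, 1], [1, 0]]"

definition pauli_Z :: "complex mat" where
  "pauli_Z = mat_of_rows_list 2 [[1, 0], [0, -1]]"

definition pauli_XZ :: "bool \<Rightarrow> bool \<Rightarrow> complex mat" where
  "pauli_XZ a b = (if a then pauli_X else 1\<^sub>m 2) * (if b then pauli_Z else 1\<^sub>m 2)"

text \<open>U_k = tensor_j X^(k_(2j-1)) Z^(k_(2j)) for a bit string k of even length;
  the first pair of bits acts on the first (most significant) qubit.\<close>
fun pauli_U :: "bool list \<Rightarrow> complex mat" where
  "pauli_U [] = 1\<^sub>m 1"
| "pauli_U [a] = 1\<^sub>m 1"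
| "pauli_U (a # b # k) = kron (pauli_XZ a b) (pauli_U k)"

text \<open>the isometry V psi = psi tensor |0>^(d1-d2), a 2^d1 x 2^d2 matrix\<close>
definition embed_V :: "nat \<Rightarrow> nat \<Rightarrow> complex mat" where
  "embed_V d1 d2 = kron (1\<^sub>m (2 ^ d2)) (mat (2 ^ (d1 - d2)) 1 (\<lambda>(i, j). if i = 0 then 1 else 0))"

definition perm_mat :: "nat \<Rightarrow> (nat \<Rightarrow> nat) \<Rightarrow> complex mat" where
  "perm_mat n \<sigma> = mat n n (\<lambda>(i, j). if i = \<sigma> j then 1 else 0)"

end

theory Submission
  imports Defs "Jordan_Normal_Form.Spectral_Radius"
begin

text \<open>
  Write \<open>A = M\<^sub>o'\<close>, \<open>C = M\<^sub>c''\<close>, \<open>e = 1/\<eta>\<close>. The spectral hypothesis gives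
  \<open>e C \<le> A / 2\<close>, which makes \<open>X = (A/2 - e C/2, e C/2; e C/2, A/2 - e C/2)\<close> positive semidefinite;
  \<open>X\<close> lies below both block states and has trace \<open>1 - e\<close>. So it suffices that
  \<open>0 \<le> X \<le> \<rho>, \<tau>\<close> implies \<open>Tr X \<le> F(\<rho>, \<tau>)\<close>. For \<open>S = \<surd>\<rho>\<close> and \<open>T = \<surd>(S \<tau> S)\<close>, the matrix
  \<open>W = S\<^sup>-\<^sup>1 X S\<close> has the trace of \<open>X\<close> and satisfies \<open>\<parallel>W v\<parallel> \<le> \<parallel>T v\<parallel>\<close> for all \<open>v\<close>; summing
  \<open>\<langle>u, W u\<rangle> \<le> \<parallel>T u\<parallel> = \<langle>u, T u\<rangle>\<close> over an orthonormal eigenbasis of \<open>T\<close> gives \<open>Tr W \<le> Tr T = F(\<rho>, \<tau>)\<close>.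
\<close>

subsection \<open>Adjoints, norms and unitary matrices\<close>

text \<open>Premises on dimensions, in place of the carrier premises of
  \<open>assoc_mult_mat\<close>, leave no intermediate size to guess, so associativity can serve as
  a conditional rewrite rule.\<close>

lemma assoc_mult_mat_dim:
  fixes A B C :: "'a :: semiring_0 mat"
  assumes "dim_col A = dim_row B" "dim_col B = dim_row C"
  shows "A * B * C = A * (B * C)"
  using assms assoc_mult_mat[of A "dim_row A" "dim_col A" B "dim_col B" C "dim_col C"]
  by (metis carrier_matI)

lemma dim_mat_adjoint [simp]:
  "dim_row (mat_adjoint A) = dim_col A" "dim_col (mat_adjoint A) = dim_row A"
  by (auto simp: mat_adjoint_def)

lemma mat_adjoint_carrier [simp]: "A \<in> carrier_mat n m \<Longrightarrow> mat_adjoint A \<in> carrier_mat m n"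
  by auto

lemma index_mat_adjoint [simp]:
  "i < dim_col A \<Longrightarrow> j < dim_row A \<Longrightarrow> mat_adjoint A $$ (i, j) = conjugate (A $$ (j, i))"
  by (auto simp: mat_adjoint_def mat_of_rows_index)

lemma mat_adjoint_adjoint [simp]: "mat_adjoint (mat_adjoint A) = A"
  by (rule eq_matI) auto

lemma mat_adjoint_mult:
  fixes A B :: "complex mat"
  assumes "A \<in> carrier_mat n m" "B \<in> carrier_mat m k"
  shows "mat_adjoint (A * B) = mat_adjoint B * mat_adjoint A"
  using assms by (intro eq_matI) (auto simp: scalar_prod_def mult.commute intro!: sum.cong)

lemma mat_adjoint_one [simp]: "mat_adjoint (1\<^sub>m n :: complex mat) = 1\<^sub>m n"
  by (rule eq_matI) auto

lemma conjugate_adjoint_sprod: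
  fixes A :: "complex mat"
  assumes "A \<in> carrier_mat n m" "v \<in> carrier_vec n" "w \<in> carrier_vec m"
  shows "conjugate v \<bullet> (A *\<^sub>v w) = conjugate (mat_adjoint A *\<^sub>v v) \<bullet> w"
proof -
  have "conjugate v \<bullet> (A *\<^sub>v w) = (\<Sum>i<n. \<Sum>j<m. cnj (v $ i) * A $$ (i, j) * w $ j)"
    using assms by (auto simp: scalar_prod_def sum_distrib_left mult.assoc atLeast0LessThan)
  also have "\<dots> = (\<Sum>j<m. \<Sum>i<n. cnj (v $ i) * A $$ (i, j) * w $ j)"
    by (rule sum.swap)
  also have "\<dots> = conjugate (mat_adjoint A *\<^sub>v v) \<bullet> w"
    using assms by (auto simp: scalar_prod_def sum_distrib_right sum_distrib_left atLeast0LessThan ac_simps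
      intro!: sum.cong)
  finally show ?thesis .
qed

lemma conjugate_sprod_swap:
  fixes v w :: "complex vec"
  assumes "v \<in> carrier_vec n" "w \<in> carrier_vec n"
  shows "conjugate v \<bullet> w = cnj (conjugate w \<bullet> v)"
  using assms by (auto simp: scalar_prod_def mult.commute)

section \<open>Euclidean norm, Cauchy-Schwarz and cyclicity of the trace\<close>

lemma vnorm_nonneg [simp]: "vnorm v \<ge> 0"
  by (simp add: vnorm_def sum_nonneg)

lemma conjugate_sprod_self: "conjugate v \<bullet> v = complex_of_real ((vnorm v)\<^sup>2)"
  by (simp add: vnorm_def sum_nonneg scalar_prod_def atLeast0LessThan mult.commute
    flip: complex_norm_square)

lemma vnorm_eq_0_iff: "v \<in> carrier_vec n \<Longrightarrow> vnorm v = 0 \<longleftrightarrow> v = 0\<^sub>v n"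
  by (auto simp: vnorm_def sum_nonneg_eq_0_iff)

lemma vnorm_smult: "vnorm (c \<cdot>\<^sub>v v) = cmod c * vnorm v"
  by (simp add: vnorm_def norm_mult power_mult_distrib real_sqrt_mult flip: sum_distrib_left)

lemma vnorm_L2: "vnorm v = L2_set (\<lambda>i. cmod (v $ i)) {..<dim_vec v}"
  by (simp add: vnorm_def L2_set_def)

lemma cmod_conjugate_sprod_le:
  assumes "v \<in> carrier_vec n" "w \<in> carrier_vec n"
  shows "cmod (conjugate v \<bullet> w) \<le> vnorm v * vnorm w"
proof -
  have "cmod (conjugate v \<bullet> w) \<le> (\<Sum>i<n. cmod (v $ i) * cmod (w $ i))"
    using assms by (auto simp: scalar_prod_def atLeast0LessThan norm_mult intro!: order_trans[OF norm_sum])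
  also have "\<dots> \<le> vnorm v * vnorm w"
    using assms L2_set_mult_ineq[of "\<lambda>i. cmod (v $ i)" "\<lambda>i. cmod (w $ i)" "{..<n}"]
    by (auto simp: vnorm_L2)
  finally show ?thesis .
qed

lemma mtrace_mult_commute:
  assumes "A \<in> carrier_mat n m" "B \<in> carrier_mat m n"
  shows "mtrace (A * B) = mtrace (B * A)"
  using assms sum.swap[of "\<lambda>i j. A $$ (i, j) * B $$ (j, i)" "{..<m}" "{..<n}"]
  by (auto simp: mtrace_def scalar_prod_def atLeast0LessThan mult.commute)

section \<open>Unitary matrices\<close>

definition unitary :: "nat \<Rightarrow> complex mat \<Rightarrow> bool" where
  "unitary n U \<longleftrightarrow> U \<in> carrier_mat n n \<and> mat_adjoint U * U = 1\<^sub>m n \<and> U * mat_adjoint U = 1\<^sub>m n"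

lemma unitaryI:
  assumes "U \<in> carrier_mat n n" "mat_adjoint U * U = 1\<^sub>m n"
  shows "unitary n U"
  using assms mat_mult_left_right_inverse[of "mat_adjoint U" n U] by (auto simp: unitary_def)

lemma unitary_mult:
  assumes "unitary n U" "unitary n V"
  shows "unitary n (U * V)"
proof (rule unitaryI)
  have c: "U \<in> carrier_mat n n" "V \<in> carrier_mat n n" using assms by (auto simp: unitary_def)
  then show "U * V \<in> carrier_mat n n" by auto
  have "mat_adjoint (U * V) * (U * V) = mat_adjoint V * (mat_adjoint U * U) * V"
    using c by (simp add: mat_adjoint_mult[OF c] assoc_mult_mat_dim)
  then show "mat_adjoint (U * V) * (U * V) = 1\<^sub>m n"
    using assms c by (simp add: unitary_def)
qed

lemma vnorm_unitary:
  assumes "unitary n U" "v \<in> carrier_vec n"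
  shows "vnorm (U *\<^sub>v v) = vnorm v"
proof -
  have U: "U \<in> carrier_mat n n" using assms by (simp add: unitary_def)
  have "conjugate (U *\<^sub>v v) \<bullet> (U *\<^sub>v v) = conjugate (mat_adjoint U *\<^sub>v (U *\<^sub>v v)) \<bullet> v"
    by (rule conjugate_adjoint_sprod) (use assms U in auto)
  also have "mat_adjoint U *\<^sub>v (U *\<^sub>v v) = v"
    using assms assoc_mult_mat_vec[of "mat_adjoint U" n n U n v] U by (simp add: unitary_def)
  finally have "(vnorm (U *\<^sub>v v))\<^sup>2 = (vnorm v)\<^sup>2"
    by (metis conjugate_sprod_self of_real_eq_iff)
  then show ?thesis by simp
qed

lemma index_adjoint_mult:
  fixes A B :: "complex mat"
  assumes "A \<in> carrier_mat n m" "B \<in> carrier_mat n k" "i < m" "j < k"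
  shows "(mat_adjoint A * B) $$ (i, j) = conjugate (col A i) \<bullet> col B j"
  using assms by (auto simp: scalar_prod_def)

subsection \<open>The spectral theorem\<close>

text \<open>This prepares the deflation in the spectral theorem. Complete \<open>v\<close> to a
  basis and apply Gram-Schmidt, which keeps the head of the list; normalising the columns then
  leaves the unit vector \<open>v\<close> in first place.\<close>

lemma unitary_col_exists:
  assumes v: "v \<in> carrier_vec n" "vnorm v = 1" "n > 0"
  shows "\<exists>U. unitary n U \<and> col U 0 = v"
proof -
  interpret cof_vec_space n "TYPE(complex)" .
  have v0: "v \<noteq> 0\<^sub>v n" using v by (metis vnorm_eq_0_iff zero_neq_one)
  define b where "b = basis_completion v"
  note bc = basis_completion[OF v(1) v0, folded b_def]
  from bc(6,7) v obtain vs where b: "b = v # vs" by (cases b) auto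
  define ws where "ws = gram_schmidt n b"
  from gram_schmidt_result[OF bc(2,4,5) ws_def] bc
  have ws: "set ws \<subseteq> carrier_vec n" "corthogonal ws" "length ws = n" by auto
  have hd: "ws ! 0 = v" 
  proof -
    have "ws \<noteq> []" using ws(3) v(3) by auto
    then show ?thesis using gram_schmidt_hd[OF v(1), of vs] by (simp add: ws_def b flip: hd_conv_nth)
  qed
  have wc: "ws ! i \<in> carrier_vec n" if "i < n" for i using that ws by auto
  have nz: "vnorm (ws ! i) \<noteq> 0" if "i < n" for i
  proof
    assume "vnorm (ws ! i) = 0"
    then have "ws ! i = 0\<^sub>v n" using vnorm_eq_0_iff wc[OF that] by blast
    then have "ws ! i \<bullet>c ws ! i = 0" by simp
    then show False using corthogonalD[OF ws(2), of i i] that ws by simp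
  qed
  \<comment> \<open>Gram-Schmidt here delivers orthogonal vectors of arbitrary nonzero length, hence
    the division by the norms.\<close>
  define U where "U = mat n n (\<lambda>(i, j). (ws ! j) $ i / complex_of_real (vnorm (ws ! j)))"
  have U: "U \<in> carrier_mat n n" by (simp add: U_def)
  have col: "col U j = (1 / complex_of_real (vnorm (ws ! j))) \<cdot>\<^sub>v ws ! j" if "j < n" for j
    using wc[OF that] that by (intro eq_vecI) (auto simp: U_def)
  have "mat_adjoint U * U = 1\<^sub>m n"
  proof (rule eq_matI)
    fix i j assume "i < dim_row (1\<^sub>m n :: complex mat)" "j < dim_col (1\<^sub>m n :: complex mat)"
    then have ij: "i < n" "j < n" by auto
    have "(mat_adjoint U * U) $$ (i, j) = conjugate (col U i) \<bullet> col U j"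
      using U ij by (rule_tac index_adjoint_mult) auto
    also have "\<dots> = (1 / complex_of_real (vnorm (ws ! i))) * (1 / complex_of_real (vnorm (ws ! j))) 
         * (conjugate (ws ! i) \<bullet> ws ! j)"
      using wc[OF ij(1)] wc[OF ij(2)]
      by (simp add: col[OF ij(1)] col[OF ij(2)] conjugate_smult_vec)
    also have "\<dots> = 1\<^sub>m n $$ (i, j)"
    proof (cases "i = j")
      case True
      then show ?thesis using nz ij by (simp add: conjugate_sprod_self power2_eq_square)
    next
      case False
      then have "ws ! j \<bullet>c ws ! i = 0" using corthogonalD[OF ws(2), of j i] ij ws by simp
      then have "conjugate (ws ! i) \<bullet> ws ! j = 0" 
        using conjugate_vec_sprod_comm[OF wc wc] ij by metis
      then show ?thesis using False ij by simp
    qed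
    finally show "(mat_adjoint U * U) $$ (i, j) = 1\<^sub>m n $$ (i, j)" .
  qed (use U in auto)
  moreover have "col U 0 = v" using col[of 0] v hd by simp
  ultimately show ?thesis using unitaryI[OF U] by blast
qed

lemma mat_adjoint_four_block:
  fixes A B C D :: "complex mat"
  assumes "A \<in> carrier_mat n1 m1" "B \<in> carrier_mat n1 m2" "C \<in> carrier_mat n2 m1" "D \<in> carrier_mat n2 m2"
  shows "mat_adjoint (four_block_mat A B C D)
    = four_block_mat (mat_adjoint A) (mat_adjoint C) (mat_adjoint B) (mat_adjoint D)"
  using assms by (intro eq_matI) auto

lemma hermitian_conj:
  assumes "hermitian A" "A \<in> carrier_mat n n" "P \<in> carrier_mat m n"
  shows "hermitian (P * A * mat_adjoint P)"
proof -
  have "mat_adjoint (P * A * mat_adjoint P) = P * (mat_adjoint A * mat_adjoint P)"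
    using assms mat_adjoint_mult[of "P * A" m n "mat_adjoint P" m] mat_adjoint_mult[of P m n A n] by simp
  also have "\<dots> = P * A * mat_adjoint P"
    using assms by (simp add: hermitian_def assoc_mult_mat_dim)
  finally show ?thesis using assms by (auto simp: hermitian_def)
qed

text \<open>Induction on the dimension by deflation: a unitary whose first column is a unit
  eigenvector reduces \<open>A\<close> to a one-by-one block and a Hermitian block of size one less.
  Taking \<open>d\<close> real-valued records that the eigenvalues are real.\<close>

lemma hermitian_spectral:
  assumes "A \<in> carrier_mat n n" "hermitian A"
  shows "\<exists>U d. unitary n U \<and> A = U * mat_diag n (\<lambda>i. complex_of_real (d i)) * mat_adjoint U"
  using assms
proof (induction n arbitrary: A)
  case 0
  have "unitary 0 (1\<^sub>m 0)" by (simp add: unitary_def)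
  moreover have "A = 1\<^sub>m 0 * mat_diag 0 (\<lambda>i. complex_of_real (0 :: real)) * mat_adjoint (1\<^sub>m 0)"
    using 0 by (intro eq_matI) auto
  ultimately show ?case by (intro exI[of _ "1\<^sub>m 0"] exI[of _ "\<lambda>_. 0"]) simp
next
  case (Suc m)
  let ?n = "Suc m"
  have A: "A \<in> carrier_mat ?n ?n" "mat_adjoint A = A" using Suc by (auto simp: hermitian_def)
  obtain e where "eigenvalue A e" using spectrum_non_empty[OF A(1)] by (auto simp: spectrum_def)
  then obtain w where w: "w \<in> carrier_vec ?n" "w \<noteq> 0\<^sub>v ?n" "A *\<^sub>v w = e \<cdot>\<^sub>v w"
    using A by (auto simp: eigenvalue_def eigenvector_def)
  have nw: "vnorm w \<noteq> 0" using w by (simp add: vnorm_eq_0_iff[OF w(1)])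
  define v where "v = (1 / complex_of_real (vnorm w)) \<cdot>\<^sub>v w"
  have v: "v \<in> carrier_vec ?n" "vnorm v = 1" "A *\<^sub>v v = e \<cdot>\<^sub>v v"
    using w nw mult_mat_vec[OF A(1) w(1)]
    by (auto simp: v_def vnorm_smult norm_divide smult_smult_assoc mult.commute)
  obtain W where W: "unitary ?n W" "col W 0 = v" using unitary_col_exists[OF v(1,2)] by auto
  have Wc: "W \<in> carrier_mat ?n ?n" and WW: "mat_adjoint W * W = 1\<^sub>m ?n" "W * mat_adjoint W = 1\<^sub>m ?n"
    using W by (auto simp: unitary_def)
  define B where "B = mat_adjoint W * A * W"
  have Bc: "B \<in> carrier_mat ?n ?n" using Wc A by (auto simp: B_def)
  have Bh: "mat_adjoint B = B" 
    using hermitian_conj[of A ?n "mat_adjoint W" ?n] Suc Wc by (simp add: B_def hermitian_def)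
  \<comment> \<open>As \<open>A\<close> scales the first column of \<open>W\<close> by
    \<open>e\<close>, the first column of \<open>B\<close> is \<open>e\<close> times that of the
    identity.\<close>
  have B0: "B $$ (i, 0) = (if i = 0 then e else 0)" if "i < ?n" for i
  proof -
    have "B = mat_adjoint W * (A * W)" using Wc A(1) by (simp add: B_def assoc_mult_mat_dim)
    then have "B $$ (i, 0) = conjugate (col W i) \<bullet> col (A * W) 0"
      using index_adjoint_mult[of W ?n ?n "A * W" ?n i 0] that Wc A by auto
    also have "col (A * W) 0 = e \<cdot>\<^sub>v col W 0" using col_mult2[OF A(1) Wc, of 0] W v by simp
    also have "conjugate (col W i) \<bullet> (e \<cdot>\<^sub>v col W 0) = e * (conjugate (col W i) \<bullet> col W 0)"
      using Wc by simp
    also have "conjugate (col W i) \<bullet> col W 0 = 1\<^sub>m ?n $$ (i, 0)"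
      using index_adjoint_mult[of W ?n ?n W ?n i 0] that Wc WW by simp
    finally show ?thesis using that by simp
  qed
  have B0': "B $$ (0, i) = (if i = 0 then cnj e else 0)" if "i < ?n" for i
    using that Bh B0[OF that] Bc index_mat_adjoint[of 0 B i] by auto
  \<comment> \<open>The row and column descriptions of the corner entry agree only if
    \<open>e\<close> is real.\<close>
  have ce: "cnj e = e" using B0[of 0] B0'[of 0] by simp
  have e: "e = complex_of_real (Re e)" using ce by (simp add: complex_eq_iff)
  define C where "C = mat m m (\<lambda>(i, j). B $$ (Suc i, Suc j))"
  have Cc: "C \<in> carrier_mat m m" by (simp add: C_def)
  have "mat_adjoint C = C"
  proof (rule eq_matI)
    fix i j assume "i < dim_row C" "j < dim_col C"
    then have ij: "i < m" "j < m" using Cc by auto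
    have "cnj (B $$ (Suc j, Suc i)) = mat_adjoint B $$ (Suc i, Suc j)"
      using Bc ij by simp
    then show "mat_adjoint C $$ (i, j) = C $$ (i, j)" using Bh ij Cc by (simp add: C_def)
  qed (use Cc in auto)
  then have "hermitian C" using Cc by (auto simp: hermitian_def)
  from Suc.IH[OF Cc this] obtain V d where V: "unitary m V" and 
    Cd: "C = V * mat_diag m (\<lambda>i. complex_of_real (d i)) * mat_adjoint V" by blast
  have Vc: "V \<in> carrier_mat m m" using V by (auto simp: unitary_def)
  \<comment> \<open>\<open>V'\<close> fixes the eigenvector and diagonalises the remaining block, so
    \<open>W * V'\<close> diagonalises \<open>A\<close>.\<close>
  define V' where "V' = four_block_mat (1\<^sub>m 1) (0\<^sub>m 1 m) (0\<^sub>m m 1) V"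
  have V'c: "V' \<in> carrier_mat ?n ?n" using Vc by (auto simp: V'_def)
  have z: "mat_adjoint (0\<^sub>m m 1) = (0\<^sub>m 1 m :: complex mat)" "mat_adjoint (0\<^sub>m 1 m) = (0\<^sub>m m 1 :: complex mat)"
    by (auto intro!: eq_matI)
  have V'a: "mat_adjoint V' = four_block_mat (1\<^sub>m 1) (0\<^sub>m 1 m) (0\<^sub>m m 1) (mat_adjoint V)"
    unfolding V'_def using Vc z by (subst mat_adjoint_four_block) auto
  have blk: "four_block_mat E (0\<^sub>m 1 m) (0\<^sub>m m 1) P * four_block_mat F (0\<^sub>m 1 m) (0\<^sub>m m 1) Q
    = four_block_mat (E * F) (0\<^sub>m 1 m) (0\<^sub>m m 1) (P * Q)"
    if "E \<in> carrier_mat 1 1" "F \<in> carrier_mat 1 1" "P \<in> carrier_mat m m" "Q \<in> carrier_mat m m"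
    for E F P Q :: "complex mat"
    using that by (subst mult_four_block_mat[of _ 1 1 _ m _ m _ _ 1 _ m]) auto
  have "mat_adjoint V' * V' = 1\<^sub>m ?n"
    unfolding V'a unfolding V'_def using Vc V
    by (simp add: blk unitary_def del: One_nat_def) (auto intro!: eq_matI)
  then have V'u: "unitary ?n V'" using V'c by (rule_tac unitaryI)
  define d' where "d' = (\<lambda>i. case i of 0 \<Rightarrow> Re e | Suc j \<Rightarrow> d j)"
  have D: "mat_diag ?n (\<lambda>i. complex_of_real (d' i)) = 
    four_block_mat (mat 1 1 (\<lambda>_. e)) (0\<^sub>m 1 m) (0\<^sub>m m 1) (mat_diag m (\<lambda>i. complex_of_real (d i)))"
    using e by (intro eq_matI) (auto simp: d'_def mat_diag_def split: nat.split)
  have B4: "B = four_block_mat (mat 1 1 (\<lambda>_. e)) (0\<^sub>m 1 m) (0\<^sub>m m 1) C"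
    using Bc B0 B0' ce by (intro eq_matI) (auto simp: C_def)
  have Dc: "mat_diag m f \<in> carrier_mat m m" for f :: "nat \<Rightarrow> complex" by simp
  have "V' * mat_diag ?n (\<lambda>i. complex_of_real (d' i)) * mat_adjoint V' = B"
    unfolding V'a D unfolding V'_def using Vc Dc[of "\<lambda>i. complex_of_real (d i)"]
    by (simp add: blk B4 Cd del: One_nat_def)
  moreover have "A = W * B * mat_adjoint W"
  proof -
    have "W * B * mat_adjoint W = (W * mat_adjoint W) * A * (W * mat_adjoint W)"
      using Wc A(1) by (simp add: B_def assoc_mult_mat_dim)
    then show ?thesis using WW A by simp
  qed
  ultimately have "A = (W * V') * mat_diag ?n (\<lambda>i. complex_of_real (d' i)) * mat_adjoint (W * V')"
    using Wc V'c
    by (auto simp add: mat_adjoint_mult[OF Wc V'c] assoc_mult_mat_dim carrier_matD[OF mat_diag_dim])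
  then show ?case using unitary_mult[OF W(1) V'u] by blast
qed

subsection \<open>Positive matrices and square roots\<close>

lemma assoc_mult_mat_vec_dim:
  fixes A B :: "'a :: semiring_0 mat"
  assumes "dim_col A = dim_row B" "dim_vec v = dim_col B"
  shows "A * B *\<^sub>v v = A *\<^sub>v (B *\<^sub>v v)"
proof (rule assoc_mult_mat_vec)
  show "A \<in> carrier_mat (dim_row A) (dim_row B)" using assms by (simp only: carrier_mat_def mem_Collect_eq)
  show "B \<in> carrier_mat (dim_row B) (dim_col B)" by (simp only: carrier_mat_def mem_Collect_eq)
  show "v \<in> carrier_vec (dim_col B)" using assms by (simp only: carrier_vec_def mem_Collect_eq)
qed

lemma mult_mat_vec_carrier_iff [simp]: "A *\<^sub>v v \<in> carrier_vec n \<longleftrightarrow> dim_row A = n"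
  by (simp only: carrier_vec_def mem_Collect_eq dim_mult_mat_vec)
lemma mult_mat_carrier_iff [simp]: "A * B \<in> carrier_mat n m \<longleftrightarrow> dim_row A = n \<and> dim_col B = m"
  by (simp only: carrier_mat_def mem_Collect_eq index_mult_mat)

lemma mult_mat_vec_zero:
  fixes A :: "'a :: semiring_0 mat"
  assumes "A \<in> carrier_mat n m" 
  shows "A *\<^sub>v 0\<^sub>v m = 0\<^sub>v n"
proof (rule eq_vecI)
qed (use assms in \<open>auto\<close>)

text \<open>The Loewner order is handled pointwise through this form: domination between matrices is
  stated as an inequality of \<open>qf\<close> at every vector.\<close>

abbreviation qf :: "complex mat \<Rightarrow> complex vec \<Rightarrow> real" where
  "qf A v \<equiv> Re (conjugate v \<bullet> (A *\<^sub>v v))"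

lemma qf_conj:
  assumes "A \<in> carrier_mat n n" "P \<in> carrier_mat m n" "v \<in> carrier_vec m"
  shows "qf (P * A * mat_adjoint P) v = qf A (mat_adjoint P *\<^sub>v v)"
proof -
  have "(P * A * mat_adjoint P) *\<^sub>v v = P *\<^sub>v (A *\<^sub>v (mat_adjoint P *\<^sub>v v))"
    using assms by (simp add: assoc_mult_mat_vec_dim)
  then show ?thesis
    using assms conjugate_adjoint_sprod[of P m n v "A *\<^sub>v (mat_adjoint P *\<^sub>v v)"] by simp
qed

lemma psd_conj:
  assumes "psd A" "A \<in> carrier_mat n n" "P \<in> carrier_mat m n"
  shows "psd (P * A * mat_adjoint P)"
  using assms hermitian_conj[of A n P m] qf_conj[of A n P m] 
  by (auto simp: psd_def)

lemma pd_imp_psd: 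
  assumes "A \<in> carrier_mat n n" "pd A" 
  shows "psd A"
  unfolding psd_def
proof (intro conjI ballI)
  fix v :: "complex vec" assume "v \<in> carrier_vec (dim_row A)"
  then show "qf A v \<ge> 0" using assms
    by (cases "v = 0\<^sub>v (dim_row A)") (auto simp: pd_def less_imp_le)
qed (use assms in \<open>auto simp: pd_def\<close>)

lemma pd_conj_unitary:
  assumes "pd A" "A \<in> carrier_mat n n" "unitary n P"
  shows "pd (P * A * mat_adjoint P)"
proof -
  have P: "P \<in> carrier_mat n n" using assms by (simp add: unitary_def)
  have "mat_adjoint P *\<^sub>v v \<noteq> 0\<^sub>v n" if "v \<in> carrier_vec n" "v \<noteq> 0\<^sub>v n" for v
  proof
    assume *: "mat_adjoint P *\<^sub>v v = 0\<^sub>v n"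
    have "v = P *\<^sub>v (mat_adjoint P *\<^sub>v v)"
      using assoc_mult_mat_vec[of P n n "mat_adjoint P" n v] assms that P by (simp add: unitary_def)
    also have "\<dots> = 0\<^sub>v n" using * P by (simp add: mult_mat_vec_zero)
    finally show False using that by simp
  qed
  then show ?thesis
    using assms P hermitian_conj[of A n P n] qf_conj[of A n P n] by (auto simp: pd_def)
qed

text \<open>Cyclicity brings \<open>mat_adjoint P * P\<close> together. The rectangular form covers
  the embedding \<open>embed_V\<close> as well as unitaries.\<close>

lemma mtrace_conj_isometry:
  assumes "A \<in> carrier_mat n n" "P \<in> carrier_mat m n" "mat_adjoint P * P = 1\<^sub>m n"
  shows "mtrace (P * A * mat_adjoint P) = mtrace A"
proof -
  have "mtrace (P * A * mat_adjoint P) = mtrace (mat_adjoint P * (P * A))"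
    using assms by (intro mtrace_mult_commute[of _ m n]) auto
  also have "mat_adjoint P * (P * A) = mat_adjoint P * P * A"
    using assms(1,2) by (simp add: assoc_mult_mat_dim)
  finally show ?thesis using assms by simp
qed

lemma unitary_adjoint: "unitary n U \<Longrightarrow> unitary n (mat_adjoint U)"
  by (auto simp: unitary_def)

lemma qf_mat_diag:
  assumes "v \<in> carrier_vec n"
  shows "qf (mat_diag n (\<lambda>i. complex_of_real (d i))) v = (\<Sum>i<n. d i * (cmod (v $ i))\<^sup>2)"
proof -
  have "mat_diag n (\<lambda>i. complex_of_real (d i)) *\<^sub>v v = vec n (\<lambda>i. complex_of_real (d i) * v $ i)"
  proof (rule eq_vecI)
    fix i assume "i < dim_vec (vec n (\<lambda>i. complex_of_real (d i) * v $ i))"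
    then have i: "i < n" by simp
    then have "(mat_diag n (\<lambda>i. complex_of_real (d i)) *\<^sub>v v) $ i
      = (\<Sum>j<n. (if i = j then complex_of_real (d j) else 0) * v $ j)"
      using assms by (simp add: mat_diag_def scalar_prod_def atLeast0LessThan)
    also have "\<dots> = (\<Sum>j<n. if i = j then complex_of_real (d j) * v $ j else 0)"
      by (intro sum.cong) auto
    finally show "(mat_diag n (\<lambda>i. complex_of_real (d i)) *\<^sub>v v) $ i 
      = vec n (\<lambda>i. complex_of_real (d i) * v $ i) $ i"
      using i by simp
  qed (simp add: mat_diag_def)
  moreover have "Re (cnj z * (complex_of_real x * z)) = x * (cmod z)\<^sup>2" for x z
    by (simp add: cmod_def algebra_simps power2_eq_square)
  ultimately show ?thesis using assms
    by (simp add: scalar_prod_def atLeast0LessThan)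
qed

text \<open>Multiplying the decomposition by \<open>U\<close> on the right cancels the adjoint and
  leaves \<open>A * U = U * mat_diag n f\<close>, which is read off column by column.\<close>

lemma spectral_col:
  assumes "unitary n U" "A = U * mat_diag n f * mat_adjoint U" "i < n"
  shows "col U i \<in> carrier_vec n" "vnorm (col U i) = 1" "A *\<^sub>v col U i = f i \<cdot>\<^sub>v col U i"
proof -
  have U: "U \<in> carrier_mat n n" "mat_adjoint U * U = 1\<^sub>m n" using assms by (auto simp: unitary_def)
  show c: "col U i \<in> carrier_vec n" using U assms by auto
  have "conjugate (col U i) \<bullet> col U i = 1"
    using index_adjoint_mult[of U n n U n i i] U assms by simp
  then have "(vnorm (col U i))\<^sup>2 = 1" using conjugate_sprod_self of_real_eq_1_iff by metis
  then show "vnorm (col U i) = 1" using vnorm_nonneg[of "col U i"] by (auto simp: power2_eq_1_iff)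
  have "A * U = U * mat_diag n f * (mat_adjoint U * U)"
    using U(1) assms(2) by (simp add: assoc_mult_mat_dim carrier_matD[OF mat_diag_dim])
  then have AU: "A * U = U * mat_diag n f" using right_mult_one_mat[of "U * mat_diag n f" n n] U 
    by (simp add: carrier_matD[OF mat_diag_dim])
  have A: "A \<in> carrier_mat n n" using U(1) assms(2) by auto
  have "A *\<^sub>v col U i = col (A * U) i" using col_mult2[OF A U(1)] assms by simp
  also have "\<dots> = f i \<cdot>\<^sub>v col U i"
    unfolding AU using U(1) assms(3) by (intro eq_vecI) (auto simp: mat_diag_mult_right)
  finally show "A *\<^sub>v col U i = f i \<cdot>\<^sub>v col U i" .
qed

lemma psd_spectral:
  assumes "A \<in> carrier_mat n n" "psd A"
  obtains U d where "unitary n U" "A = U * mat_diag n (\<lambda>i. complex_of_real (d i)) * mat_adjoint U"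
    "\<And>i. i < n \<Longrightarrow> d i \<ge> 0"
proof -
  obtain U d where U: "unitary n U" "A = U * mat_diag n (\<lambda>i. complex_of_real (d i)) * mat_adjoint U"
    using hermitian_spectral[of A n] assms by (auto simp: psd_def)
  have "d i \<ge> 0" if "i < n" for i
  proof -
    note c = spectral_col[OF U that]
    have "qf A (col U i) = d i"
      unfolding c(3) using c(1,2) by (simp add: conjugate_sprod_self)
    then show ?thesis using assms c(1) by (auto simp: psd_def)
  qed
  then show ?thesis using that U by blast
qed

lemma psd_sqrt_exists:
  assumes "A \<in> carrier_mat n n" "psd A"
  shows "\<exists>B. B \<in> carrier_mat n n \<and> psd B \<and> B * B = A"
proof -
  obtain U d where U: "unitary n U" "A = U * mat_diag n (\<lambda>i. complex_of_real (d i)) * mat_adjoint U"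
    and d: "\<And>i. i < n \<Longrightarrow> d i \<ge> 0" using psd_spectral[OF assms] by blast
  define D where "D = mat_diag n (\<lambda>i. complex_of_real (sqrt (d i)))"
  have D: "D \<in> carrier_mat n n" by (simp add: D_def)
  have "mat_adjoint D = D" by (rule eq_matI) (auto simp: D_def mat_diag_def)
  then have "psd D" using D qf_mat_diag[of _ n "\<lambda>i. sqrt (d i)"] d
    by (auto simp: psd_def hermitian_def D_def[symmetric] intro!: sum_nonneg mult_nonneg_nonneg)
  have Uc: "U \<in> carrier_mat n n" "mat_adjoint U * U = 1\<^sub>m n" using U by (auto simp: unitary_def)
  define B where "B = U * D * mat_adjoint U"
  have "psd B" using psd_conj[OF \<open>psd D\<close> D Uc(1)] by (simp add: B_def)
  moreover have "B * B = A"
  proof -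
    have DD: "D * D = mat_diag n (\<lambda>i. complex_of_real (d i))"
      unfolding D_def mat_diag_diag using d by (intro eq_matI) (auto simp: mat_diag_def simp flip: of_real_mult)
    have "B * B = U * D * (mat_adjoint U * U) * D * mat_adjoint U"
      using Uc(1) D by (simp add: B_def assoc_mult_mat_dim)
    also have "\<dots> = U * (D * D) * mat_adjoint U"
      unfolding Uc(2) using Uc(1) D by (simp add: assoc_mult_mat_dim)
    finally show ?thesis using U DD by simp
  qed
  moreover have "B \<in> carrier_mat n n" using Uc(1) D by (simp add: B_def)
  ultimately show ?thesis by blast
qed

text \<open>For an eigenvector \<open>v\<close> of \<open>B - C\<close> with eigenvalue \<open>t\<close>, the identity 
  \<open>B (B - C) + (B - C) C = 0\<close> gives \<open>t (qf B v + qf C v) = 0\<close>.\<close>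

lemma psd_sqrt_unique:
  assumes B: "B \<in> carrier_mat n n" "psd B" and C: "C \<in> carrier_mat n n" "psd C"
    and eq: "B * B = C * C"
  shows "B = C"
proof -
  define D where "D = B - C"
  have Dc: "D \<in> carrier_mat n n" using B C by (simp add: D_def minus_carrier_mat)
  have Bh: "mat_adjoint B = B" and Ch: "mat_adjoint C = C" using B C by (auto simp: psd_def hermitian_def)
  have "mat_adjoint D = D"
  proof (rule eq_matI)
    fix i j assume ij: "i < dim_row D" "j < dim_col D"
    have "mat_adjoint B $$ (i,j) = cnj (B $$ (j, i))" "mat_adjoint C $$ (i,j) = cnj (C $$ (j, i))" 
      using ij B C Dc by auto
    then show "mat_adjoint D $$ (i, j) = D $$ (i, j)"
      using ij B C Dc Bh Ch by (simp add: D_def)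
  qed (use Dc in auto)
  then have Dh: "hermitian D" using Dc by (auto simp: hermitian_def)
  then obtain U d where U: "unitary n U" "D = U * mat_diag n (\<lambda>i. complex_of_real (d i)) * mat_adjoint U"
    using hermitian_spectral[OF Dc] by blast
  have "d i = 0" if i: "i < n" for i
  proof (rule ccontr)
    assume nz: "d i \<noteq> 0"
    define v where "v = col U i"
    note c = spectral_col[OF U i, folded v_def]
    let ?t = "complex_of_real (d i)"
    have Bv: "B *\<^sub>v v \<in> carrier_vec n" "C *\<^sub>v v \<in> carrier_vec n" using B C c by auto
    have Dw: "D *\<^sub>v w = B *\<^sub>v w - C *\<^sub>v w" if "w \<in> carrier_vec n" for w
      using B C that by (simp add: D_def minus_mult_distrib_mat_vec)
    have BD: "B *\<^sub>v v - C *\<^sub>v v = ?t \<cdot>\<^sub>v v" using c Dw by simp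
    \<comment> \<open>Since the squares agree, \<open>B * D = C * C - B * C\<close>, which is the
      negative of \<open>D * C\<close>.\<close>
    have "conjugate v \<bullet> (B *\<^sub>v (D *\<^sub>v v)) = conjugate v \<bullet> (C *\<^sub>v (C *\<^sub>v v)) - conjugate v \<bullet> (B *\<^sub>v (C *\<^sub>v v))"
    proof -
      have "B *\<^sub>v (B *\<^sub>v v) = (B * B) *\<^sub>v v" using B c by simp
      also have "\<dots> = C *\<^sub>v (C *\<^sub>v v)" unfolding eq using C c by simp
      finally have "B *\<^sub>v (D *\<^sub>v v) = C *\<^sub>v (C *\<^sub>v v) - B *\<^sub>v (C *\<^sub>v v)"
        unfolding Dw[OF c(1)] using B Bv by (simp add: mult_minus_distrib_mat_vec)
      then show ?thesis using B C Bv c by (simp add: scalar_prod_minus_distrib[of _ n])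
    qed
    also have "\<dots> = - (conjugate v \<bullet> (D *\<^sub>v (C *\<^sub>v v)))"
      using B C Bv c by (simp add: Dw scalar_prod_minus_distrib[of _ n])
    also have "conjugate v \<bullet> (D *\<^sub>v (C *\<^sub>v v)) = conjugate (D *\<^sub>v v) \<bullet> (C *\<^sub>v v)"
      using conjugate_adjoint_sprod[OF Dc c(1) Bv(2)] Dh by (simp add: hermitian_def)
    also have "\<dots> = ?t * (conjugate v \<bullet> (C *\<^sub>v v))"
      using c Bv by (simp add: conjugate_smult_vec)
    also have "conjugate v \<bullet> (B *\<^sub>v (D *\<^sub>v v)) = ?t * (conjugate v \<bullet> (B *\<^sub>v v))"
      using c B by (simp add: mult_mat_vec)
    finally have "?t * (conjugate v \<bullet> (B *\<^sub>v v) + conjugate v \<bullet> (C *\<^sub>v v)) = 0"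
      by (simp add: algebra_simps)
    then have "conjugate v \<bullet> (B *\<^sub>v v) + conjugate v \<bullet> (C *\<^sub>v v) = 0" using nz by simp
    then have "Re (conjugate v \<bullet> (B *\<^sub>v v) + conjugate v \<bullet> (C *\<^sub>v v)) = 0" by (metis zero_complex.sel(1))
    then have "qf B v + qf C v = 0" by simp
    moreover have "qf B v \<ge> 0" "qf C v \<ge> 0" using B C c by (auto simp: psd_def)
    ultimately have z: "qf B v = 0" "qf C v = 0" by auto
    \<comment> \<open>Both forms vanish at the unit vector \<open>v\<close>, yet the eigenvalue of
      \<open>B - C\<close> there is their difference, which contradicts \<open>nz\<close>.\<close>
    have "d i = Re (conjugate v \<bullet> (?t \<cdot>\<^sub>v v))" using c by (simp add: conjugate_sprod_self)
    also have "\<dots> = qf B v - qf C v"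
      unfolding BD[symmetric] using Bv c by (simp add: scalar_prod_minus_distrib[of _ n])
    finally show False using z nz by simp
  qed
  then have "mat_diag n (\<lambda>i. complex_of_real (d i)) = 0\<^sub>m n n"
    by (intro eq_matI) (auto simp: mat_diag_def)
  then have D0: "D = 0\<^sub>m n n" using U right_mult_zero_mat[of U n n n] left_mult_zero_mat[of "mat_adjoint U" n n n] 
    by (simp add: unitary_def)
  show ?thesis
  proof (rule eq_matI)
    fix i j assume ij: "i < dim_row C" "j < dim_col C"
    have "D $$ (i, j) = 0" unfolding D0 using ij C by simp
    then show "B $$ (i, j) = C $$ (i, j)" using ij B C by (simp add: D_def)
  qed (use B C in auto)
qed

text \<open>Existence and uniqueness together make the definite description in
  \<open>mat_sqrt\<close> denote the root.\<close>

lemma mat_sqrt: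
  assumes "A \<in> carrier_mat n n" "psd A"
  shows "mat_sqrt A \<in> carrier_mat n n" "psd (mat_sqrt A)" "mat_sqrt A * mat_sqrt A = A"
proof -
  have "\<exists>!B. B \<in> carrier_mat (dim_row A) (dim_row A) \<and> psd B \<and> B * B = A"
    using psd_sqrt_exists[OF assms] psd_sqrt_unique assms(1) by (metis carrier_matD(1))
  from theI'[OF this] show "mat_sqrt A \<in> carrier_mat n n" "psd (mat_sqrt A)" "mat_sqrt A * mat_sqrt A = A"
    using assms by (auto simp: mat_sqrt_def)
qed

section \<open>Inverses of positive definite matrices\<close>

lemma pd_inverse_exists:
  assumes "A \<in> carrier_mat n n" "pd A"
  shows "\<exists>B. B \<in> carrier_mat n n \<and> A * B = 1\<^sub>m n \<and> B * A = 1\<^sub>m n"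
proof -
  \<comment> \<open>A nonzero kernel vector would give the form the value 0, against
    definiteness.\<close>
  have "det A \<noteq> 0"
  proof
    assume "det A = 0"
    then obtain v where v: "v \<in> carrier_vec n" "v \<noteq> 0\<^sub>v n" "A *\<^sub>v v = 0\<^sub>v n"
      using det_0_iff_vec_prod_zero_field[OF assms(1)] by auto
    then have "qf A v = 0" by simp
    then show False using assms v by (auto simp: pd_def)
  qed
  from det_non_zero_imp_unit[OF assms(1) this] 
  show ?thesis by (auto simp: Units_def ring_mat_def)
qed

lemma mat_inv_pd:
  assumes "A \<in> carrier_mat n n" "pd A"
  shows "mat_inv A \<in> carrier_mat n n" "A * mat_inv A = 1\<^sub>m n" "mat_inv A * A = 1\<^sub>m n"
proof -
  have "\<exists>!B. B \<in> carrier_mat (dim_row A) (dim_row A) \<and> A * B = 1\<^sub>m (dim_row A) \<and> B * A = 1\<^sub>m (dim_row A)"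
  proof (rule ex_ex1I)
    show "\<exists>B. B \<in> carrier_mat (dim_row A) (dim_row A) \<and> A * B = 1\<^sub>m (dim_row A) \<and> B * A = 1\<^sub>m (dim_row A)"
      using pd_inverse_exists[OF assms] assms by auto
    fix B C assume B: "B \<in> carrier_mat (dim_row A) (dim_row A) \<and> A * B = 1\<^sub>m (dim_row A) \<and> B * A = 1\<^sub>m (dim_row A)"
     and C: "C \<in> carrier_mat (dim_row A) (dim_row A) \<and> A * C = 1\<^sub>m (dim_row A) \<and> C * A = 1\<^sub>m (dim_row A)"
    have "B * (A * C) = B * A * C" 
      using B C assms(1) by (intro assoc_mult_mat[symmetric, of _ n n _ n _ n]) auto
    moreover have "B * 1\<^sub>m (dim_row A) = B" "1\<^sub>m (dim_row A) * C = C"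
      using B C right_mult_one_mat[of B] left_mult_one_mat[of C] by blast+
    ultimately show "B = C" using B C by auto
  qed
  from theI'[OF this] show "mat_inv A \<in> carrier_mat n n" "A * mat_inv A = 1\<^sub>m n" "mat_inv A * A = 1\<^sub>m n"
    using assms by (auto simp: mat_inv_def)
qed

subsection \<open>A lower bound for the fidelity\<close>

text \<open>Expand \<open>qf A (v - w)\<close>, which is nonnegative. This AM-GM version of
  Cauchy-Schwarz avoids square roots; it is applied below to the witness \<open>X\<close>, to
  \<open>A\<close> and to \<open>C\<close>.\<close>

lemma psd_sprod_le:
  assumes A: "A \<in> carrier_mat n n" "psd A" and v: "v \<in> carrier_vec n" "w \<in> carrier_vec n"
  shows "2 * Re (conjugate v \<bullet> (A *\<^sub>v w)) \<le> qf A v + qf A w"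
proof -
  have c: "A *\<^sub>v v \<in> carrier_vec n" "A *\<^sub>v w \<in> carrier_vec n" using A v by auto
  have "conjugate w \<bullet> (A *\<^sub>v v) = conjugate (A *\<^sub>v w) \<bullet> v"
    using conjugate_adjoint_sprod[OF A(1) v(2,1)] A by (simp add: psd_def hermitian_def)
  also have "\<dots> = cnj (conjugate v \<bullet> (A *\<^sub>v w))" using conjugate_sprod_swap c v by blast
  finally have s: "Re (conjugate w \<bullet> (A *\<^sub>v v)) = Re (conjugate v \<bullet> (A *\<^sub>v w))" by simp
  have cm: "conjugate (v - w) = conjugate v - conjugate w"
    using v by (intro eq_vecI) auto
  have "0 \<le> qf A (v - w)" using A v by (auto simp: psd_def)
  also have "qf A (v - w) = qf A v - Re (conjugate v \<bullet> (A *\<^sub>v w)) - Re (conjugate w \<bullet> (A *\<^sub>v v)) + qf A w"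
    using v c A by (simp add: cm mult_minus_distrib_mat_vec[of A n n] scalar_prod_minus_distrib[of _ n] 
      minus_scalar_prod_distrib[of _ n])
  finally show ?thesis using s by simp
qed

text \<open>The norm hypothesis says that \<open>mat_adjoint W * W\<close> lies below
  \<open>T * T\<close>; \<open>W\<close> may fail to be Hermitian. The trace is evaluated in an
  eigenbasis of \<open>T\<close>, where the norm of \<open>T u\<close> equals its diagonal
  entry.\<close>

lemma mtrace_le_psd:
  assumes T: "T \<in> carrier_mat n n" "psd T" and W: "W \<in> carrier_mat n n"
    and le: "\<And>v. v \<in> carrier_vec n \<Longrightarrow> vnorm (W *\<^sub>v v) \<le> vnorm (T *\<^sub>v v)"
  shows "Re (mtrace W) \<le> Re (mtrace T)"
proof -
  obtain U d where U: "unitary n U" "T = U * mat_diag n (\<lambda>i. complex_of_real (d i)) * mat_adjoint U"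
    and d: "\<And>i. i < n \<Longrightarrow> d i \<ge> 0" using psd_spectral[OF T] by blast
  have Uc: "U \<in> carrier_mat n n" using U by (simp add: unitary_def)
  have tr: "mtrace M = (\<Sum>i<n. conjugate (col U i) \<bullet> (M *\<^sub>v col U i))" if M: "M \<in> carrier_mat n n" for M
  proof -
    have "mtrace M = mtrace (mat_adjoint U * M * mat_adjoint (mat_adjoint U))"
      using mtrace_conj_isometry[OF M, of "mat_adjoint U" n] U by (simp add: unitary_def)
    also have "mat_adjoint U * M * mat_adjoint (mat_adjoint U) = mat_adjoint U * (M * U)"
      using Uc M by (simp add: assoc_mult_mat_dim)
    also have "mtrace \<dots> = (\<Sum>i<n. conjugate (col U i) \<bullet> (M *\<^sub>v col U i))"
    proof -
      have "(mat_adjoint U * (M * U)) $$ (i, i) = conjugate (col U i) \<bullet> (M *\<^sub>v col U i)" if "i < n" for i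
        using index_adjoint_mult[of U n n "M * U" n i i] Uc M col_mult2[OF M Uc that] that by simp
      then show ?thesis unfolding mtrace_def using Uc by (intro sum.cong) simp_all
    qed
    finally show ?thesis .
  qed
  have "Re (conjugate (col U i) \<bullet> (W *\<^sub>v col U i)) \<le> Re (conjugate (col U i) \<bullet> (T *\<^sub>v col U i))" if i: "i < n" for i
  proof -
    note c = spectral_col[OF U i]
    have "Re (conjugate (col U i) \<bullet> (W *\<^sub>v col U i)) \<le> cmod (conjugate (col U i) \<bullet> (W *\<^sub>v col U i))"
      by (rule complex_Re_le_cmod)
    also have "\<dots> \<le> vnorm (col U i) * vnorm (W *\<^sub>v col U i)"
      using c W by (intro cmod_conjugate_sprod_le[of _ n]) auto
    also have "\<dots> \<le> vnorm (T *\<^sub>v col U i)" using le[OF c(1)] c(2) by simp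
    \<comment> \<open>The norm is the absolute value of the eigenvalue, and eigenvalues of
      \<open>T\<close> are nonnegative.\<close>
    also have "\<dots> = d i" unfolding c(3) using d[OF i] c(2) by (simp add: vnorm_smult)
    also have "\<dots> = Re (conjugate (col U i) \<bullet> (T *\<^sub>v col U i))"
      unfolding c(3) using c(1,2) by (simp add: conjugate_sprod_self)
    finally show ?thesis .
  qed
  then show ?thesis using tr T W by (auto intro!: sum_mono)
qed

lemma vnorm_sq_psd_mult:
  assumes "S \<in> carrier_mat n n" "hermitian S" "v \<in> carrier_vec n"
  shows "(vnorm (S *\<^sub>v v))\<^sup>2 = qf (S * S) v"
proof -
  have "qf (S * S) v = Re (conjugate v \<bullet> (S *\<^sub>v (S *\<^sub>v v)))" using assms by simp
  also have "\<dots> = Re (conjugate (S *\<^sub>v v) \<bullet> (S *\<^sub>v v))"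
    using conjugate_adjoint_sprod[of S n n v "S *\<^sub>v v"] assms by (simp add: hermitian_def)
  finally show ?thesis by (simp add: conjugate_sprod_self)
qed

lemma fidelity_ge_trace:
  assumes \<rho>: "\<rho> \<in> carrier_mat n n" "pd \<rho>" and \<tau>: "\<tau> \<in> carrier_mat n n" "psd \<tau>"
    and X: "X \<in> carrier_mat n n" "psd X"
    and X\<rho>: "\<And>v. v \<in> carrier_vec n \<Longrightarrow> qf X v \<le> qf \<rho> v"
    and X\<tau>: "\<And>v. v \<in> carrier_vec n \<Longrightarrow> qf X v \<le> qf \<tau> v"
  shows "Re (mtrace X) \<le> fidelity \<rho> \<tau>"
proof -
  define S where "S = mat_sqrt \<rho>"
  have S: "S \<in> carrier_mat n n" "psd S" "S * S = \<rho>" "hermitian S" "mat_adjoint S = S"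
    using mat_sqrt[OF \<rho>(1) pd_imp_psd[OF \<rho>]] by (auto simp: S_def psd_def hermitian_def)
  obtain R where R: "R \<in> carrier_mat n n" "\<rho> * R = 1\<^sub>m n" "R * \<rho> = 1\<^sub>m n"
    using pd_inverse_exists[OF \<rho>] by blast
  \<comment> \<open>\<open>Z\<close> is the inverse of \<open>S\<close>, because
    \<open>S * (S * R) = \<rho> * R\<close> is the identity.\<close>
  define Z where "Z = S * R"
  have Z: "Z \<in> carrier_mat n n" using S R by (simp add: Z_def)
  have SZ: "S * Z = 1\<^sub>m n" 
  proof -
    have "S * Z = (S * S) * R" unfolding Z_def using S(1) R(1) by (simp add: assoc_mult_mat_dim)
    then show ?thesis using S R by simp
  qed
  then have ZS: "Z * S = 1\<^sub>m n" using mat_mult_left_right_inverse[OF S(1) Z] by simp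
  define G where "G = S * \<tau> * S"
  have G: "G \<in> carrier_mat n n" "psd G" using psd_conj[OF \<tau>(2,1) S(1)] S \<tau> by (auto simp: G_def)
  define T where "T = mat_sqrt G"
  have T: "T \<in> carrier_mat n n" "psd T" "T * T = G" "hermitian T"
    using mat_sqrt[OF G] by (auto simp: T_def psd_def)
  define W where "W = Z * X * S"
  have W: "W \<in> carrier_mat n n" using Z X S by (simp add: W_def)
  have "vnorm (W *\<^sub>v v) \<le> vnorm (T *\<^sub>v v)" if v: "v \<in> carrier_vec n" for v
  proof -
    define u where "u = S *\<^sub>v v"
    have u: "u \<in> carrier_vec n" using S v by (simp add: u_def)
    define w where "w = W *\<^sub>v v"
    have w: "w \<in> carrier_vec n" using W v by (simp add: w_def)
    \<comment> \<open>With \<open>S y = w\<close> and \<open>S w = X u\<close>, both the pairing of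
      \<open>y\<close> with \<open>X u\<close> and the form of \<rho> at \<open>y\<close> equal the
      squared norm of \<open>w\<close>. AM-GM for \<open>X\<close> at \<open>y\<close> and
      \<open>u\<close> thus has one copy of that square to spare.\<close>
    define y where "y = Z *\<^sub>v w"
    have y: "y \<in> carrier_vec n" using Z w by (simp add: y_def)
    have Sy: "S *\<^sub>v y = w" using assoc_mult_mat_vec[OF S(1) Z w] w by (simp add: y_def SZ)
    have Sw: "S *\<^sub>v w = X *\<^sub>v u"
    proof -
      have "w = Z *\<^sub>v (X *\<^sub>v u)" using Z X S v by (simp add: w_def W_def u_def assoc_mult_mat_vec_dim)
      then show ?thesis using assoc_mult_mat_vec[OF S(1) Z, of "X *\<^sub>v u"] X u by (simp add: SZ)
    qed
    have "conjugate y \<bullet> (X *\<^sub>v u) = conjugate y \<bullet> (S *\<^sub>v w)" by (simp add: Sw)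
    also have "\<dots> = conjugate (S *\<^sub>v y) \<bullet> w" using conjugate_adjoint_sprod[OF S(1) y w] S by simp
    also have "\<dots> = complex_of_real ((vnorm w)\<^sup>2)" by (simp add: Sy conjugate_sprod_self)
    finally have "2 * (vnorm w)\<^sup>2 \<le> qf X y + qf X u"
      using psd_sprod_le[OF X y u] by simp
    also have "qf X y \<le> qf \<rho> y" using X\<rho> y by simp
    also have "qf \<rho> y = (vnorm w)\<^sup>2"
      using vnorm_sq_psd_mult[OF S(1,4) y] by (simp add: S(3) Sy)
    also have "qf X u \<le> qf \<tau> u" using X\<tau> u by simp
    \<comment> \<open>\<open>G\<close> is \<tau> conjugated by \<open>S\<close>, so its form at
      \<open>v\<close> is that of \<tau> at \<open>u\<close>; \<open>T\<close> is the root of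
      \<open>G\<close>.\<close>
    also have "qf \<tau> u = (vnorm (T *\<^sub>v v))\<^sup>2"
      using vnorm_sq_psd_mult[OF T(1,4) v] qf_conj[OF \<tau>(1) S(1) v] by (simp add: T(3) G_def S(5) u_def)
    finally have "(vnorm w)\<^sup>2 \<le> (vnorm (T *\<^sub>v v))\<^sup>2" by simp
    then show ?thesis unfolding w_def by (rule power2_le_imp_le) simp
  qed
  from mtrace_le_psd[OF T(1,2) W this] have "Re (mtrace W) \<le> Re (mtrace T)" .
  \<comment> \<open>\<open>W\<close> is similar to \<open>X\<close> through \<open>S\<close>, so
    cyclicity suffices.\<close>
  moreover have "mtrace W = mtrace X"
  proof -
    have "mtrace W = mtrace (S * (Z * X))"
      unfolding W_def using Z X S by (intro mtrace_mult_commute[of _ n n]) auto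
    also have "S * (Z * X) = S * Z * X" using S(1) Z X(1) by (simp add: assoc_mult_mat_dim)
    finally show ?thesis using SZ X by simp
  qed
  ultimately show ?thesis by (simp add: fidelity_def T_def G_def S_def)
qed

subsection \<open>Kronecker products and Pauli operators\<close>

lemma kron_carrier [simp]:
  "A \<in> carrier_mat n m \<Longrightarrow> B \<in> carrier_mat p q \<Longrightarrow> kron A B \<in> carrier_mat (n * p) (m * q)"
  by (auto simp: kron_def)

lemma mod_less_of_less_mult: "i < n * m \<Longrightarrow> i mod m < (m :: nat)"
  by (cases "m = 0") auto

text \<open>Quotient and remainder by \<open>q\<close> identify the indices below
  \<open>m * q\<close> with pairs, matching the index convention of \<open>kron\<close>.\<close>

lemma sum_div_mod:
  fixes f :: "nat \<Rightarrow> nat \<Rightarrow> 'a :: comm_monoid_add"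
  shows "(\<Sum>l<m * q. f (l div q) (l mod q)) = (\<Sum>a<m. \<Sum>b<q. f a b)"
proof -
  have "(\<Sum>l<m * q. f (l div q) (l mod q)) = (\<Sum>(a, b)\<in>{..<m} \<times> {..<q}. f a b)"
  proof (rule sum.reindex_bij_witness[of _ "\<lambda>(a, b). a * q + b" "\<lambda>l. (l div q, l mod q)"], goal_cases)
    case (4 ab)
    then obtain a b where "ab = (a, b)" "a < m" "b < q" by auto
    moreover have "a * q + b < m * q"
    proof -
      have "a * q + b < Suc a * q" using \<open>b < q\<close> by simp
      also have "\<dots> \<le> m * q" using \<open>a < m\<close> by (intro mult_right_mono) auto
      finally show ?thesis .
    qed
    ultimately show ?case by simp
  qed (auto simp: less_mult_imp_div_less mod_less_of_less_mult)
  then show ?thesis by (simp add: sum.cartesian_product)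
qed

text \<open>Mixed-product rule: the sum over the middle index becomes a double sum over quotient and
  remainder, and this factors.\<close>

lemma kron_mult:
  assumes "A \<in> carrier_mat n m" "B \<in> carrier_mat p q" "C \<in> carrier_mat m k" "D \<in> carrier_mat q r"
  shows "kron A B * kron C D = kron (A * C) (B * D)"
proof (rule eq_matI)
  fix i j assume "i < dim_row (kron (A * C) (B * D))" "j < dim_col (kron (A * C) (B * D))"
  then have ij: "i < n * p" "j < k * r" using assms by (auto simp: kron_def)
  note lt = less_mult_imp_div_less[OF ij(1)] mod_less_of_less_mult[OF ij(1)]
    less_mult_imp_div_less[OF ij(2)] mod_less_of_less_mult[OF ij(2)]
  have "(kron A B * kron C D) $$ (i, j) = (\<Sum>l<m * q. (A $$ (i div p, l div q) * C $$ (l div q, j div r)) 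
      * (B $$ (i mod p, l mod q) * D $$ (l mod q, j mod r)))"
    using assms ij by (auto simp: kron_def scalar_prod_def atLeast0LessThan ac_simps intro!: sum.cong)
  also have "\<dots> = (\<Sum>a<m. \<Sum>b<q. (A $$ (i div p, a) * C $$ (a, j div r)) * (B $$ (i mod p, b) * D $$ (b, j mod r)))"
    by (rule sum_div_mod)
  also have "\<dots> = (\<Sum>a<m. A $$ (i div p, a) * C $$ (a, j div r)) * (\<Sum>b<q. B $$ (i mod p, b) * D $$ (b, j mod r))"
    by (simp add: sum_product)
  also have "\<dots> = kron (A * C) (B * D) $$ (i, j)"
    using assms ij lt by (auto simp: kron_def scalar_prod_def atLeast0LessThan)
  finally show "(kron A B * kron C D) $$ (i, j) = kron (A * C) (B * D) $$ (i, j)" .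
qed (use assms in \<open>auto simp: kron_def\<close>)

lemma mat_adjoint_kron: "mat_adjoint (kron A B) = kron (mat_adjoint A) (mat_adjoint B)"
  by (rule eq_matI) (auto simp: kron_def less_mult_imp_div_less mod_less_of_less_mult)

lemma kron_one: "kron (1\<^sub>m n) (1\<^sub>m m) = 1\<^sub>m (n * m)"
proof (rule eq_matI)
  fix i j assume "i < dim_row (1\<^sub>m (n * m) :: complex mat)" "j < dim_col (1\<^sub>m (n * m) :: complex mat)"
  then have ij: "i < n * m" "j < n * m" by auto
  have "i = j \<longleftrightarrow> i div m = j div m \<and> i mod m = j mod m" by (metis div_mult_mod_eq)
  then show "kron (1\<^sub>m n) (1\<^sub>m m) $$ (i, j) = 1\<^sub>m (n * m) $$ (i, j)"
    using ij by (auto simp: kron_def less_mult_imp_div_less mod_less_of_less_mult)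
qed (auto simp: kron_def)

text \<open>Rectangular factors are allowed so that one argument serves both tensor products of
  unitaries and the embedding.\<close>

lemma kron_isometry:
  assumes "A \<in> carrier_mat n m" "B \<in> carrier_mat p q"
    and "mat_adjoint A * A = 1\<^sub>m m" "mat_adjoint B * B = 1\<^sub>m q"
  shows "mat_adjoint (kron A B) * kron A B = 1\<^sub>m (m * q)"
  using assms kron_mult[of "mat_adjoint A" m n "mat_adjoint B" q p A m B q]
  by (simp add: mat_adjoint_kron kron_one)

lemma unitary_kron: "unitary n A \<Longrightarrow> unitary m B \<Longrightarrow> unitary (n * m) (kron A B)"
  by (rule unitaryI) (auto simp: unitary_def intro!: kron_isometry)

lemma unitary_one: "unitary n (1\<^sub>m n)"
  by (simp add: unitary_def)

section \<open>Pauli unitaries, the embedding isometry and permutation matrices\<close>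

lemma unitary_pauli_XZ: "unitary 2 (pauli_XZ a b)"
proof -
  have "unitary 2 pauli_X" "unitary 2 pauli_Z"
    by (rule unitaryI; 
        auto simp: pauli_X_def pauli_Z_def mat_of_rows_list_def scalar_prod_def numeral_2_eq_2 less_Suc_eq intro!: eq_matI)+
  then show ?thesis by (auto simp: pauli_XZ_def intro!: unitary_mult unitary_one)
qed

lemma unitary_pauli_U: "length k = 2 * d \<Longrightarrow> unitary (2 ^ d) (pauli_U k)"
proof (induction k arbitrary: d rule: pauli_U.induct)
  case (3 a b k)
  then obtain d' where "d = Suc d'" "length k = 2 * d'" by (cases d) auto
  then show ?case using unitary_kron[OF unitary_pauli_XZ "3.IH"] by simp
qed (auto simp: unitary_one)

lemma embed_V_carrier: "d2 \<le> d1 \<Longrightarrow> embed_V d1 d2 \<in> carrier_mat (2 ^ d1) (2 ^ d2)"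
  by (auto simp: embed_V_def kron_def simp flip: power_add)

lemma embed_V_isometry: "mat_adjoint (embed_V d1 d2) * embed_V d1 d2 = 1\<^sub>m (2 ^ d2)"
proof -
  let ?e = "mat (2 ^ (d1 - d2)) 1 (\<lambda>(i, j). if i = 0 then 1 else 0) :: complex mat"
  have "mat_adjoint ?e * ?e = 1\<^sub>m 1"
    by (rule eq_matI) (auto simp: scalar_prod_def if_distrib sum.delta cong: if_cong)
  then show ?thesis
    unfolding embed_V_def
    using kron_isometry[of "1\<^sub>m (2 ^ d2)" "2 ^ d2" "2 ^ d2" ?e "2 ^ (d1 - d2)" 1] by simp
qed

lemma unitary_perm_mat:
  assumes "\<sigma> permutes {..<n}"
  shows "unitary n (perm_mat n \<sigma>)"
proof (rule unitaryI)
  show "mat_adjoint (perm_mat n \<sigma>) * perm_mat n \<sigma> = 1\<^sub>m n"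
  proof (rule eq_matI)
    fix i j assume "i < dim_row (1\<^sub>m n :: complex mat)" "j < dim_col (1\<^sub>m n :: complex mat)"
    then have ij: "i < n" "j < n" by auto
    \<comment> \<open>Injectivity of \<sigma> makes the columns distinct basis vectors, hence
      orthonormal.\<close>
    have "\<sigma> i < n" "\<sigma> i = \<sigma> j \<longleftrightarrow> i = j" 
      using permutes_in_image[OF assms] ij permutes_inj[OF assms] by (auto simp: inj_eq)
    moreover have "(mat_adjoint (perm_mat n \<sigma>) * perm_mat n \<sigma>) $$ (i, j) 
       = (\<Sum>l<n. cnj (if l = \<sigma> i then 1 else 0) * (if l = \<sigma> j then 1 else 0))"
      using ij by (simp add: perm_mat_def scalar_prod_def atLeast0LessThan)
    moreover have "\<dots> = (\<Sum>l<n. if l = \<sigma> i then (if \<sigma> i = \<sigma> j then 1 else 0) else 0)"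
      by (intro sum.cong) auto
    ultimately show "(mat_adjoint (perm_mat n \<sigma>) * perm_mat n \<sigma>) $$ (i, j) = 1\<^sub>m n $$ (i, j)"
      using ij by simp
  qed (auto simp: perm_mat_def)
qed (simp add: perm_mat_def)

subsection \<open>Operator norm and smallest eigenvalue\<close>

text \<open>A crude entrywise bound, there to show that the set under the supremum in
  \<open>op_norm\<close> is bounded above.\<close>

lemma vnorm_mult_mat_vec_le:
  assumes "M \<in> carrier_mat n m" "v \<in> carrier_vec m" "vnorm v \<le> 1"
  shows "vnorm (M *\<^sub>v v) \<le> (\<Sum>i<n. \<Sum>j<m. cmod (M $$ (i, j)))"
proof -
  have v: "cmod (v $ j) \<le> 1" if "j < m" for j
    using member_le_L2_set[of "{..<m}" j "\<lambda>i. cmod (v $ i)"] that assms by (simp add: vnorm_L2)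
  have "vnorm (M *\<^sub>v v) \<le> (\<Sum>i<n. \<bar>cmod ((M *\<^sub>v v) $ i)\<bar>)"
    using assms L2_set_le_sum_abs[of "\<lambda>i. cmod ((M *\<^sub>v v) $ i)" "{..<n}"] by (simp add: vnorm_L2)
  also have "\<dots> \<le> (\<Sum>i<n. \<Sum>j<m. cmod (M $$ (i, j)))"
  proof (rule sum_mono)
    fix i assume "i \<in> {..<n}"
    then have "\<bar>cmod ((M *\<^sub>v v) $ i)\<bar> = cmod (\<Sum>j<m. M $$ (i, j) * v $ j)"
      using assms by (simp add: scalar_prod_def atLeast0LessThan)
    also have "\<dots> \<le> (\<Sum>j<m. cmod (M $$ (i, j)) * cmod (v $ j))"
      by (rule order_trans[OF norm_sum]) (simp add: norm_mult)
    also have "\<dots> \<le> (\<Sum>j<m. cmod (M $$ (i, j)))"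
      using v by (intro sum_mono) (simp add: mult_left_le)
    finally show "\<bar>cmod ((M *\<^sub>v v) $ i)\<bar> \<le> (\<Sum>j<m. cmod (M $$ (i, j)))" .
  qed
  finally show ?thesis .
qed

lemma vnorm_le_op_norm:
  assumes M: "M \<in> carrier_mat n m" and v: "v \<in> carrier_vec m"
  shows "vnorm (M *\<^sub>v v) \<le> op_norm M * vnorm v"
proof (cases "v = 0\<^sub>v m")
  case True
  then have "M *\<^sub>v v = 0\<^sub>v n" using M mult_mat_vec_zero by blast
  then show ?thesis using True by (simp add: vnorm_def)
next
  case False
  then have pos: "vnorm v > 0" using vnorm_eq_0_iff[OF v] vnorm_nonneg[of v] by linarith
  \<comment> \<open>Rescaling brings \<open>v\<close> into the unit ball over which
    \<open>op_norm\<close> takes its supremum.\<close>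
  let ?c = "complex_of_real (1 / vnorm v)"
  have "vnorm (M *\<^sub>v (?c \<cdot>\<^sub>v v)) \<le> op_norm M"
    unfolding op_norm_def
  proof (rule cSup_upper)
    show "bdd_above {vnorm (M *\<^sub>v v) | v. v \<in> carrier_vec (dim_col M) \<and> vnorm v \<le> 1}"
      using vnorm_mult_mat_vec_le[OF M] M by (intro bdd_aboveI) auto
    have "vnorm (?c \<cdot>\<^sub>v v) \<le> 1" unfolding vnorm_smult norm_of_real using pos by simp
    then show "vnorm (M *\<^sub>v (?c \<cdot>\<^sub>v v)) \<in> {vnorm (M *\<^sub>v v) | v. v \<in> carrier_vec (dim_col M) \<and> vnorm v \<le> 1}"
      using M v by (intro CollectI exI[of _ "?c \<cdot>\<^sub>v v"]) auto
  qed
  then show ?thesis using pos unfolding mult_mat_vec[OF M v] vnorm_smult norm_of_real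
    by (simp add: field_simps)
qed

lemma qf_le_op_norm:
  assumes "M \<in> carrier_mat n n" "v \<in> carrier_vec n"
  shows "qf M v \<le> op_norm M * (vnorm v)\<^sup>2"
proof -
  have "qf M v \<le> vnorm v * vnorm (M *\<^sub>v v)"
    using assms by (intro order_trans[OF complex_Re_le_cmod] cmod_conjugate_sprod_le) auto
  also have "\<dots> \<le> vnorm v * (op_norm M * vnorm v)"
    using vnorm_le_op_norm[OF assms] by (intro mult_left_mono) auto
  finally show ?thesis by (simp add: power2_eq_square mult_ac)
qed

text \<open>In eigenbasis coordinates the form is a sum of squared moduli weighted by eigenvalues,
  each of which is at least \<open>lambda_min A\<close>.\<close>

lemma lambda_min_le_qf:
  assumes A: "A \<in> carrier_mat n n" "hermitian A" and v: "v \<in> carrier_vec n"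
  shows "lambda_min A * (vnorm v)\<^sup>2 \<le> qf A v"
proof -
  obtain U d where U: "unitary n U" "A = U * mat_diag n (\<lambda>i. complex_of_real (d i)) * mat_adjoint U"
    using hermitian_spectral[OF A] by blast
  have Uc: "U \<in> carrier_mat n n" using U by (simp add: unitary_def)
  \<comment> \<open>\<open>Min\<close> needs a finite set; the eigenvalues are the roots of a
    nonzero polynomial.\<close>
  have "{l. eigenvalue A l} = {l. poly (char_poly A) l = 0}"
    using eigenvalue_root_char_poly[OF A(1)] by simp
  moreover have "char_poly A \<noteq> 0" using degree_monic_char_poly[OF A(1)] by auto
  ultimately have fin: "finite {l. eigenvalue A l}" using poly_roots_finite by simp
  have le: "lambda_min A \<le> d i" if "i < n" for i
  proof -
    note c = spectral_col[OF U that]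
    have "col U i \<noteq> 0\<^sub>v n" using c(2) vnorm_eq_0_iff[OF c(1)] by auto
    then have "eigenvalue A (complex_of_real (d i))"
      using c A by (auto simp: eigenvalue_def eigenvector_def)
    then have "d i \<in> Re ` {l. eigenvalue A l}" by (force intro: image_eqI[of _ _ "complex_of_real (d i)"])
    then show ?thesis unfolding lambda_min_def using fin by (intro Min_le) auto
  qed
  define w where "w = mat_adjoint U *\<^sub>v v"
  have w: "w \<in> carrier_vec n" using Uc by (simp add: w_def)
  have "lambda_min A * (vnorm v)\<^sup>2 = lambda_min A * (vnorm w)\<^sup>2"
    unfolding w_def using vnorm_unitary[OF unitary_adjoint[OF U(1)] v] by simp
  also have "\<dots> = (\<Sum>i<n. lambda_min A * (cmod (w $ i))\<^sup>2)"
    using w by (simp add: vnorm_def sum_nonneg sum_distrib_left)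
  also have "\<dots> \<le> (\<Sum>i<n. d i * (cmod (w $ i))\<^sup>2)"
    using le by (intro sum_mono mult_right_mono) auto
  also have "\<dots> = qf A v"
    using qf_mat_diag[OF w, of d] qf_conj[OF mat_diag_dim Uc v, of "\<lambda>i. complex_of_real (d i)"] U(2)
    by (simp add: w_def)
  finally show ?thesis .
qed

lemma qf_smult_vec:
  assumes "A \<in> carrier_mat n n" "v \<in> carrier_vec n"
  shows "qf A (complex_of_real c \<cdot>\<^sub>v v) = c\<^sup>2 * qf A v"
proof -
  have "A *\<^sub>v v \<in> carrier_vec n" using assms by simp
  then show ?thesis using assms
    by (simp add: mult_mat_vec[OF assms] conjugate_smult_vec power2_eq_square mult.assoc)
qed

text \<open>With \<open>g = A\<^sup>-\<^sup>1 C v\<close> one has \<open>qf C v = Re \<langle>v, A g\<rangle>\<close> and \<open>qf A g = qf (C A\<^sup>-\<^sup>1 C) v\<close>,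
  so this is AM-GM for the form of \<open>A\<close>, applied to \<open>v\<close> and \<open>2 e g\<close>.\<close>

lemma qf_domination:
  assumes A: "A \<in> carrier_mat n n" "pd A" and C: "C \<in> carrier_mat n n" "hermitian C"
    and cond: "e\<^sup>2 * op_norm (C * mat_inv A * C) \<le> 1/4 * lambda_min A"
    and v: "v \<in> carrier_vec n"
  shows "2 * e * qf C v \<le> qf A v"
proof -
  note R = mat_inv_pd[OF A]
  define g where "g = mat_inv A *\<^sub>v (C *\<^sub>v v)"
  have Cv: "C *\<^sub>v v \<in> carrier_vec n" using C by simp
  have g: "g \<in> carrier_vec n" using R by (simp add: g_def)
  have Ag: "A *\<^sub>v g = C *\<^sub>v v"
    using assoc_mult_mat_vec[OF A(1) R(1) Cv] R(2) Cv by (simp add: g_def)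
  have Mv: "C * mat_inv A * C *\<^sub>v v = C *\<^sub>v g"
    using C R(1) v by (simp add: g_def assoc_mult_mat_vec_dim)
  have "conjugate v \<bullet> (C *\<^sub>v g) = conjugate (C *\<^sub>v v) \<bullet> g"
    using conjugate_adjoint_sprod[OF C(1) v g] C(2) by (simp add: hermitian_def)
  also have "\<dots> = cnj (conjugate g \<bullet> (C *\<^sub>v v))" by (rule conjugate_sprod_swap[OF Cv g])
  finally have gg: "qf A g = qf (C * mat_inv A * C) v" by (simp add: Ag Mv)
  have M: "C * mat_inv A * C \<in> carrier_mat n n" using C R by simp
  let ?c = "complex_of_real (2 * e)"
  have cg: "?c \<cdot>\<^sub>v g \<in> carrier_vec n" using g by simp
  have "A *\<^sub>v (?c \<cdot>\<^sub>v g) = ?c \<cdot>\<^sub>v (C *\<^sub>v v)" using mult_mat_vec[OF A(1) g] Ag by simp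
  then have "conjugate v \<bullet> (A *\<^sub>v (?c \<cdot>\<^sub>v g)) = ?c * (conjugate v \<bullet> (C *\<^sub>v v))" using Cv v by simp
  then have "Re (conjugate v \<bullet> (A *\<^sub>v (?c \<cdot>\<^sub>v g))) = 2 * e * qf C v" by simp
  then have "2 * (2 * e * qf C v) \<le> qf A v + qf A (?c \<cdot>\<^sub>v g)"
    using psd_sprod_le[OF A(1) pd_imp_psd[OF A] v cg] by simp
  \<comment> \<open>Scaling by \<open>2 * e\<close> yields a factor 4 that cancels the 1/4 in
    \<open>cond\<close>. This term is then also at most \<open>qf A v\<close>, and halving the
    inequality gives the claim.\<close>
  also have "qf A (?c \<cdot>\<^sub>v g) = 4 * (e\<^sup>2 * qf (C * mat_inv A * C) v)"
    unfolding qf_smult_vec[OF A(1) g] gg by (simp add: power_mult_distrib)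
  also have "\<dots> \<le> 4 * (e\<^sup>2 * (op_norm (C * mat_inv A * C) * (vnorm v)\<^sup>2))"
    using qf_le_op_norm[OF M v] by (intro mult_left_mono) auto
  also have "\<dots> = 4 * (e\<^sup>2 * op_norm (C * mat_inv A * C)) * (vnorm v)\<^sup>2" by simp
  also have "\<dots> \<le> lambda_min A * (vnorm v)\<^sup>2"
    using cond by (intro mult_right_mono) auto
  also have "\<dots> \<le> qf A v" using lambda_min_le_qf[OF A(1) _ v] A by (simp add: pd_def)
  finally show ?thesis by simp
qed

subsection \<open>Block states\<close>

lemma mat_adjoint_smult: "mat_adjoint (c \<cdot>\<^sub>m A) = cnj c \<cdot>\<^sub>m mat_adjoint A"
  by (rule eq_matI) auto

lemma mat_adjoint_add:
  fixes A B :: "complex mat"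
  shows "A \<in> carrier_mat n m \<Longrightarrow> B \<in> carrier_mat n m \<Longrightarrow> mat_adjoint (A + B) = mat_adjoint A + mat_adjoint B"
  by (rule eq_matI) auto

lemma qf_four_block:
  assumes "A \<in> carrier_mat n n" "B \<in> carrier_mat n n" "C \<in> carrier_mat n n" "D \<in> carrier_mat n n"
    and "a \<in> carrier_vec n" "b \<in> carrier_vec n"
  shows "qf (four_block_mat A B C D) (a @\<^sub>v b)
    = qf A a + Re (conjugate a \<bullet> (B *\<^sub>v b)) + Re (conjugate b \<bullet> (C *\<^sub>v a)) + qf D b"
proof -
  have "conjugate (a @\<^sub>v b) = conjugate a @\<^sub>v conjugate b" by (rule eq_vecI) auto
  moreover have "conjugate c \<bullet> (M *\<^sub>v x + N *\<^sub>v y) = conjugate c \<bullet> (M *\<^sub>v x) + conjugate c \<bullet> (N *\<^sub>v y)"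
    if "c \<in> carrier_vec n" "M \<in> carrier_mat n n" "N \<in> carrier_mat n n" for c x y and M N :: "complex mat"
    using that by (intro scalar_prod_add_distrib[of _ n]) auto
  ultimately show ?thesis using assms four_block_mat_mult_vec[OF assms]
    scalar_prod_append[of "conjugate a" n "conjugate b" n "A *\<^sub>v a + B *\<^sub>v b" "C *\<^sub>v a + D *\<^sub>v b"]
    by simp
qed

lemma mtrace_four_block:
  assumes "A \<in> carrier_mat n n" "D \<in> carrier_mat n n"
  shows "mtrace (four_block_mat A B C D) = mtrace A + mtrace D"
proof -
  have "mtrace (four_block_mat A B C D) = (\<Sum>i<n. A $$ (i, i)) + (\<Sum>i<n. D $$ (i, i))"
    using assms by (simp add: mtrace_def lessThan_atLeast0 sum.atLeastLessThan_concat[of 0 n "n + n", symmetric]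
      sum.shift_bounds_nat_ivl[of _ 0 n n, simplified])
  then show ?thesis using assms by (simp add: mtrace_def)
qed

lemma smult_mat_mult_vec:
  fixes A :: "complex mat"
  assumes "A \<in> carrier_mat n m" "v \<in> carrier_vec m"
  shows "(c \<cdot>\<^sub>m A) *\<^sub>v v = c \<cdot>\<^sub>v (A *\<^sub>v v)"
  using assms by (intro eq_vecI) auto

text \<open>Conjugating the witness along with the two states preserves positivity, both dominations
  and the trace.\<close>

lemma fidelity_unitary_ge_trace:
  assumes "\<rho> \<in> carrier_mat n n" "pd \<rho>" "\<tau> \<in> carrier_mat n n" "psd \<tau>" "X \<in> carrier_mat n n" "psd X"
    and "\<And>v. v \<in> carrier_vec n \<Longrightarrow> qf X v \<le> qf \<rho> v"
    and "\<And>v. v \<in> carrier_vec n \<Longrightarrow> qf X v \<le> qf \<tau> v"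
    and P: "unitary n P"
  shows "Re (mtrace X) \<le> fidelity (P * \<rho> * mat_adjoint P) (P * \<tau> * mat_adjoint P)"
proof -
  have Pc: "P \<in> carrier_mat n n" "mat_adjoint P * P = 1\<^sub>m n" using P by (auto simp: unitary_def)
  have "Re (mtrace (P * X * mat_adjoint P)) \<le> fidelity (P * \<rho> * mat_adjoint P) (P * \<tau> * mat_adjoint P)"
    using assms Pc by (intro fidelity_ge_trace[of _ n])
      (auto simp: qf_conj[of _ n P n] intro!: pd_conj_unitary psd_conj)
  then show ?thesis using mtrace_conj_isometry[OF assms(5) Pc] by simp
qed

text \<open>The witness for \<open>fidelity_ge_trace\<close> is the minorant \<open>(\<rho> + \<tau> - \<bar>\<rho> - \<tau>\<bar>) / 2\<close> of the two states.\<close>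

lemma fidelity_block_ge:
  assumes A: "A \<in> carrier_mat n n" "pd A" and C: "C \<in> carrier_mat n n" "psd C"
    and e: "e \<ge> 0" and dom: "\<And>v. v \<in> carrier_vec n \<Longrightarrow> 2 * e * qf C v \<le> qf A v"
    and P: "unitary (n + n) P"
    and \<rho>_def: "\<rho> = four_block_mat (complex_of_real (1/2) \<cdot>\<^sub>m A) (0\<^sub>m n n) (0\<^sub>m n n) (complex_of_real (1/2) \<cdot>\<^sub>m A)"
    and \<tau>_def: "\<tau> = four_block_mat (complex_of_real (1/2) \<cdot>\<^sub>m A) (complex_of_real e \<cdot>\<^sub>m C)
      (complex_of_real e \<cdot>\<^sub>m C) (complex_of_real (1/2) \<cdot>\<^sub>m A)"
  shows "Re (mtrace A) - e * Re (mtrace C) \<le> fidelity (P * \<rho> * mat_adjoint P) (P * \<tau> * mat_adjoint P)"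
proof -
  \<comment> \<open>Subtracting \<open>e/2\<close> times \<open>C\<close> on the diagonal pays for
    the off-diagonal blocks of \<open>X\<close>, and it lowers the trace by exactly \<open>e\<close>
    times that of \<open>C\<close>.\<close>
  define Y where "Y = complex_of_real (1/2) \<cdot>\<^sub>m A + complex_of_real (- e/2) \<cdot>\<^sub>m C"
  define X where "X = four_block_mat Y (complex_of_real (e/2) \<cdot>\<^sub>m C) (complex_of_real (e/2) \<cdot>\<^sub>m C) Y"
  have Ah: "mat_adjoint A = A" and Ch: "mat_adjoint C = C" using A C by (auto simp: pd_def psd_def hermitian_def)
  have Y: "Y \<in> carrier_mat n n" "mat_adjoint Y = Y" using A C
    by (auto simp: Y_def mat_adjoint_add[of _ n n] mat_adjoint_smult Ah Ch)
  have z: "mat_adjoint (0\<^sub>m n n) = (0\<^sub>m n n :: complex mat)" by (rule eq_matI) auto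
  have c: "\<rho> \<in> carrier_mat (n + n) (n + n)" "\<tau> \<in> carrier_mat (n + n) (n + n)" "X \<in> carrier_mat (n + n) (n + n)"
    using A C Y by (auto simp: \<rho>_def \<tau>_def X_def)
  have h: "hermitian \<rho>" "hermitian \<tau>" "hermitian X"
    using A C Y c
    by (auto simp: hermitian_def \<rho>_def \<tau>_def X_def mat_adjoint_four_block[of _ n n _ n _ n] mat_adjoint_smult Ah Ch z)
  have Yv: "conjugate a \<bullet> (Y *\<^sub>v a) = complex_of_real (1/2) * (conjugate a \<bullet> (A *\<^sub>v a)) 
      + complex_of_real (- e/2) * (conjugate a \<bullet> (C *\<^sub>v a))" if "a \<in> carrier_vec n" for a
    using that A C 
    by (simp add: Y_def add_mult_distrib_mat_vec[of _ n n] smult_mat_mult_vec[of _ n n] scalar_prod_add_distrib[of _ n])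
  have Yq: "qf Y a = qf A a / 2 - e / 2 * qf C a" if "a \<in> carrier_vec n" for a
    unfolding Yv[OF that] by simp
  have sm: "conjugate a \<bullet> ((r \<cdot>\<^sub>m M) *\<^sub>v b) = r * (conjugate a \<bullet> (M *\<^sub>v b))"
    if "M \<in> carrier_mat n n" "a \<in> carrier_vec n" "b \<in> carrier_vec n" for a b r and M :: "complex mat"
    using that by (simp add: smult_mat_mult_vec[of _ n n])
  have sym: "Re (conjugate b \<bullet> (C *\<^sub>v a)) = Re (conjugate a \<bullet> (C *\<^sub>v b))"
    if "a \<in> carrier_vec n" "b \<in> carrier_vec n" for a b
    using conjugate_adjoint_sprod[OF C(1) that(2,1)] conjugate_sprod_swap[of "C *\<^sub>v b" n a] that C(1)
    by (simp add: Ch)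
  have q\<rho>: "qf \<rho> (a @\<^sub>v b) = qf A a / 2 + qf A b / 2" if ab: "a \<in> carrier_vec n" "b \<in> carrier_vec n" for a b
  proof -
    have "0\<^sub>m n n *\<^sub>v x = 0\<^sub>v n" if "x \<in> carrier_vec n" for x :: "complex vec"
      using that by (intro eq_vecI) auto
    moreover have "conjugate x \<bullet> 0\<^sub>v n = 0" if "x \<in> carrier_vec n" for x :: "complex vec"
      using that by simp
    ultimately show ?thesis
      unfolding \<rho>_def using ab A by (subst qf_four_block[of _ n]) (simp_all add: sm)
  qed
  have q\<tau>: "qf \<tau> (a @\<^sub>v b) = qf A a / 2 + qf A b / 2 + 2 * e * Re (conjugate a \<bullet> (C *\<^sub>v b))" 
    if ab: "a \<in> carrier_vec n" "b \<in> carrier_vec n" for a b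
    unfolding \<tau>_def using ab A C by (subst qf_four_block[of _ n]) (simp_all add: sm sym[OF ab])
  have qX: "qf X (a @\<^sub>v b) = qf A a / 2 + qf A b / 2 - e / 2 * (qf C a + qf C b) + e * Re (conjugate a \<bullet> (C *\<^sub>v b))" 
    if ab: "a \<in> carrier_vec n" "b \<in> carrier_vec n" for a b
    unfolding X_def using ab Y C by (subst qf_four_block[of _ n]) (simp_all add: sm sym[OF ab] Yq algebra_simps)
  \<comment> \<open>The second sign follows from the first on replacing \<open>b\<close> by its
    negative. The first gives domination by \<rho>; the second gives domination by \<tau> and
    positivity of \<open>X\<close>.\<close>
  have amgm: "2 * Re (conjugate a \<bullet> (C *\<^sub>v b)) \<le> qf C a + qf C b" 
     "- 2 * Re (conjugate a \<bullet> (C *\<^sub>v b)) \<le> qf C a + qf C b"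
    if ab: "a \<in> carrier_vec n" "b \<in> carrier_vec n" for a b
  proof -
    show "2 * Re (conjugate a \<bullet> (C *\<^sub>v b)) \<le> qf C a + qf C b" by (rule psd_sprod_le[OF C ab])
    let ?b = "complex_of_real (-1) \<cdot>\<^sub>v b"
    have "C *\<^sub>v ?b = complex_of_real (-1) \<cdot>\<^sub>v (C *\<^sub>v b)" using mult_mat_vec[OF C(1) ab(2)] by blast
    then have "conjugate a \<bullet> (C *\<^sub>v ?b) = complex_of_real (-1) * (conjugate a \<bullet> (C *\<^sub>v b))"
      using ab C(1) by simp
    moreover have "?b \<in> carrier_vec n" using ab by simp
    ultimately show "- 2 * Re (conjugate a \<bullet> (C *\<^sub>v b)) \<le> qf C a + qf C b"
      using psd_sprod_le[OF C ab(1), of ?b] qf_smult_vec[OF C(1) ab(2), of "-1"] by simp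
  qed
  have split: "\<exists>a b. v = a @\<^sub>v b \<and> a \<in> carrier_vec n \<and> b \<in> carrier_vec n" if "v \<in> carrier_vec (n + n)"
    for v :: "complex vec"
    using vec_first_last_append[OF that] by (metis vec_first_carrier vec_last_carrier)
  have X0: "qf X v \<ge> 0" and X\<rho>: "qf X v \<le> qf \<rho> v" and X\<tau>: "qf X v \<le> qf \<tau> v" if "v \<in> carrier_vec (n + n)" for v
  proof -
    obtain a b where v: "v = a @\<^sub>v b" and ab: "a \<in> carrier_vec n" "b \<in> carrier_vec n" using split \<open>v \<in> _\<close> by blast
    let ?s = "Re (conjugate a \<bullet> (C *\<^sub>v b))"
    have 1: "e * (2 * ?s) \<le> e * (qf C a + qf C b)" "e * (- 2 * ?s) \<le> e * (qf C a + qf C b)"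
      using mult_left_mono[OF amgm(1)[OF ab] e] mult_left_mono[OF amgm(2)[OF ab] e] .
    show "qf X v \<le> qf \<rho> v" "qf X v \<le> qf \<tau> v"
      unfolding v q\<rho>[OF ab] q\<tau>[OF ab] qX[OF ab] using 1 by (simp_all add: algebra_simps)
    \<comment> \<open>The cross term costs at most another \<open>e/2\<close> times the two forms of
      \<open>C\<close>, so \<open>e\<close> times them in total, and \<open>dom\<close> bounds this
      by half the forms of \<open>A\<close>.\<close>
    show "qf X v \<ge> 0"
      unfolding v qX[OF ab] using 1(2) dom[OF ab(1)] dom[OF ab(2)] by (simp add: algebra_simps)
  qed
  have "psd X" using h c X0 by (auto simp: psd_def)
  \<comment> \<open>\<tau> inherits positivity from the smaller matrix \<open>X\<close>.\<close>
  moreover have "psd \<tau>" using h c X0 X\<tau> by (fastforce simp: psd_def intro: order_trans)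
  moreover have "pd \<rho>"
    unfolding pd_def
  proof (intro conjI ballI impI)
    fix v :: "complex vec" assume v: "v \<in> carrier_vec (dim_row \<rho>)" "v \<noteq> 0\<^sub>v (dim_row \<rho>)"
    then have "v \<in> carrier_vec (n + n)" using c by simp
    then obtain a b where ab: "v = a @\<^sub>v b" "a \<in> carrier_vec n" "b \<in> carrier_vec n" using split by blast
    have "a \<noteq> 0\<^sub>v n \<or> b \<noteq> 0\<^sub>v n"
    proof (rule ccontr)
      assume "\<not> ?thesis"
      then have "v = 0\<^sub>v (n + n)" using ab by (intro eq_vecI) auto
      then show False using v c by simp
    qed
    moreover have "qf A a \<ge> 0" "qf A b \<ge> 0" using pd_imp_psd[OF A] A ab by (auto simp: psd_def)
    moreover have "a \<noteq> 0\<^sub>v n \<longrightarrow> qf A a > 0" "b \<noteq> 0\<^sub>v n \<longrightarrow> qf A b > 0" using A ab by (auto simp: pd_def)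
    ultimately show "qf \<rho> v > 0" unfolding ab(1) q\<rho>[OF ab(2,3)] by auto
  qed (rule h)
  ultimately have "Re (mtrace X) \<le> fidelity (P * \<rho> * mat_adjoint P) (P * \<tau> * mat_adjoint P)"
    using c X\<rho> X\<tau> P by (intro fidelity_unitary_ge_trace)
  moreover have "mtrace X = mtrace A - complex_of_real e * mtrace C"
    unfolding X_def mtrace_four_block[OF Y(1) Y(1)] using A C
    by (simp add: mtrace_def Y_def sum.distrib sum_distrib_left algebra_simps sum_subtractf flip: sum.distrib)
  ultimately show ?thesis by simp
qed

section \<open>Application to the two ciphertext states\<close>

theorem theorem15:
  fixes d1 d2 \<eta> :: nat and \<epsilon> :: real
    and Mo Mc :: "complex mat" and k k' :: "bool list" and \<sigma> :: "nat \<Rightarrow> nat"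
  assumes "d1 \<ge> d2" and "d2 \<ge> 1"
    and "density_mat (2 ^ d1) Mo" and "pd Mo"
    and "density_mat (2 ^ d2) Mc"
    and "length k = 2 * d1" and "length k' = 2 * d2"
    and "\<eta> > 0"
    and "\<sigma> permutes {..<2 ^ (d1 + 1)}"
    and "\<epsilon> > 0"
  defines "Mo' \<equiv> pauli_U k * Mo * mat_adjoint (pauli_U k)"
    and "Mc' \<equiv> pauli_U k' * Mc * mat_adjoint (pauli_U k')"
  defines "Mc'' \<equiv> embed_V d1 d2 * Mc' * mat_adjoint (embed_V d1 d2)"
  defines "Ma0 \<equiv> four_block_mat ((1/2 :: complex) \<cdot>\<^sub>m Mo') (0\<^sub>m (2 ^ d1) (2 ^ d1))
                                (0\<^sub>m (2 ^ d1) (2 ^ d1)) ((1/2 :: complex) \<cdot>\<^sub>m Mo')"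
    and "Ma1 \<equiv> four_block_mat ((1/2 :: complex) \<cdot>\<^sub>m Mo') ((1 / of_nat \<eta> :: complex) \<cdot>\<^sub>m Mc'')
                                ((1 / of_nat \<eta> :: complex) \<cdot>\<^sub>m mat_adjoint Mc'') ((1/2 :: complex) \<cdot>\<^sub>m Mo')"
  defines "Mf0 \<equiv> perm_mat (2 ^ (d1 + 1)) \<sigma> * Ma0 * mat_adjoint (perm_mat (2 ^ (d1 + 1)) \<sigma>)"
    and "Mf1 \<equiv> perm_mat (2 ^ (d1 + 1)) \<sigma> * Ma1 * mat_adjoint (perm_mat (2 ^ (d1 + 1)) \<sigma>)"
  assumes "1 / real \<eta> < \<epsilon>"
    and "1 / (real \<eta>)\<^sup>2 * op_norm (Mc'' * mat_inv Mo' * Mc'') \<le> 1/4 * lambda_min Mo'"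
  shows "fidelity Mf0 Mf1 \<ge> 1 - 1 / real \<eta>"
proof -
  let ?n = "2 ^ d1 :: nat"
  let ?m = "2 ^ d2 :: nat"
  have U: "unitary ?n (pauli_U k)" "unitary ?m (pauli_U k')"
    using unitary_pauli_U \<open>length k = _\<close> \<open>length k' = _\<close> by auto
  then have Uc: "pauli_U k \<in> carrier_mat ?n ?n" "pauli_U k' \<in> carrier_mat ?m ?m" 
    "mat_adjoint (pauli_U k) * pauli_U k = 1\<^sub>m ?n" "mat_adjoint (pauli_U k') * pauli_U k' = 1\<^sub>m ?m"
    by (auto simp: unitary_def)
  have Mo: "Mo \<in> carrier_mat ?n ?n" "mtrace Mo = 1" and Mc: "Mc \<in> carrier_mat ?m ?m" "psd Mc" "mtrace Mc = 1"
    using \<open>density_mat _ Mo\<close> \<open>density_mat _ Mc\<close> by (auto simp: density_mat_def)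
  have A: "Mo' \<in> carrier_mat ?n ?n" "pd Mo'" "mtrace Mo' = 1"
    using Uc Mo pd_conj_unitary[OF \<open>pd Mo\<close> Mo(1) U(1)] mtrace_conj_isometry[OF Mo(1) Uc(1,3)] 
    by (auto simp: Mo'_def)
  have C': "Mc' \<in> carrier_mat ?m ?m" "psd Mc'" "mtrace Mc' = 1"
    using Uc Mc psd_conj[OF Mc(2,1) Uc(2)] mtrace_conj_isometry[OF Mc(1) Uc(2,4)] 
    by (auto simp: Mc'_def)
  have V: "embed_V d1 d2 \<in> carrier_mat ?n ?m" using embed_V_carrier \<open>d1 \<ge> d2\<close> .
  have C: "Mc'' \<in> carrier_mat ?n ?n" "psd Mc''" "mtrace Mc'' = 1"
    using V C' psd_conj[OF C'(2,1) V] mtrace_conj_isometry[OF C'(1) V embed_V_isometry] 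
    by (auto simp: Mc''_def)
  have Ch: "hermitian Mc''" using C by (simp add: psd_def)
  \<comment> \<open>The extra qubit doubles the dimension; the block lemmas expect the size as a
    sum.\<close>
  have n2: "2 ^ (d1 + 1) = ?n + ?n" by simp
  have P: "unitary (?n + ?n) (perm_mat (2 ^ (d1 + 1)) \<sigma>)"
    using unitary_perm_mat[OF \<open>\<sigma> permutes _\<close>] unfolding n2 .
  have "(1 / real \<eta>)\<^sup>2 * op_norm (Mc'' * mat_inv Mo' * Mc'') \<le> 1/4 * lambda_min Mo'"
    using assms by (simp add: power_divide)
  note dom = qf_domination[OF A(1,2) C(1) Ch this]
  \<comment> \<open>\<open>Mc''\<close> is Hermitian, so both off-diagonal blocks of
    \<open>Ma1\<close> have the form required by \<open>fidelity_block_ge\<close>. Since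
    \<open>Mo'\<close> and \<open>Mc''\<close> have trace 1, the left side is
    \<open>1 - 1 / real \<eta>\<close>.\<close>
  have "Re (mtrace Mo') - 1 / real \<eta> * Re (mtrace Mc'') \<le> fidelity Mf0 Mf1"
    unfolding Mf0_def Mf1_def
    by (rule fidelity_block_ge[OF A(1,2) C(1,2) _ dom P])
      (use Ch in \<open>simp_all add: Ma0_def Ma1_def hermitian_def\<close>)
  then show ?thesis using A C by simp
qed

end
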